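(* Let $X$ be a Peano continuum and let $\mathrm{inffree}(H_1(X))$ be the largest quotient of $H_1(X)$ having no nonzero infinitely divisible elements. If $\mathrm{card}(\mathrm{inffree}(H_1(X))) < 2^{\aleph_0}$, then $\mathrm{inffree}(H_1(X))$ is a free abelian group of finite rank.
   Context: A Peano continuum is a path connected, locally path connected, compact metrizable space. An element $a$ of an abelian group $A$ is infinitely divisible if $a$ is divisible by infinitely many positive integers $n$ (i.e. for infinitely many $n$ there is $b\in A$ with $nb=a$). For an abelian group $A$, $\mathrm{inffree}(A)=A/B$ where $B$ is the smallest subgroup such that $A/B$ has no nonzero infinitely divisible elements; concretely, $S_0$ is the set of infinitely divisible elements of $A$, $S_{\alpha+1}$ is the set of elements mapping to infinitely divisible elements of $A/\langle S_\alpha\rangle$, $S_\beta=\bigcup_{\alpha<\beta}S_\alpha$ at limits, and $B=\bigcup_\alpha\langle S_\alpha\rangle$ once the process stabilizes. Every homomorphism from $A$ to an abelian group with no nonzero infinitely divisible elements factors through $A/B$. *)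

theory Defs
  imports "HOL-Analysis.Analysis" "HOL-Homology.Homology" "HOL-Library.Equipollence"
begin

definition Peano_continuum :: "'a topology \<Rightarrow> bool" where
  "Peano_continuum X \<longleftrightarrow> path_connected_space X \<and> locally_path_connected_space X
     \<and> compact_space X \<and> metrizable_space X"

text \<open>Abelian groups are written multiplicatively (HOL-Algebra); n b = b [^] n.
  An element a is infinitely divisible if it is divisible by infinitely many positive n.\<close>
definition inf_divisible :: "('g, 'm) monoid_scheme \<Rightarrow> 'g \<Rightarrow> bool" where
  "inf_divisible G a \<longleftrightarrow>
     infinite {n::nat. 0 < n \<and> (\<exists>b\<in>carrier G. b [^]\<^bsub>G\<^esub> n = a)}"

definition no_inf_divisible :: "('g, 'm) monoid_scheme \<Rightarrow> bool" where
  "no_inf_divisible G \<longleftrightarrow> (\<forall>a\<in>carrier G. inf_divisible G a \<longrightarrow> a = \<one>\<^bsub>G\<^esub>)"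

text \<open>B: the smallest subgroup whose quotient has no nonzero infinitely divisible
  elements (taken as the intersection of all such subgroups).\<close>
definition inffree_kernel :: "('g, 'm) monoid_scheme \<Rightarrow> 'g set" where
  "inffree_kernel G = \<Inter>{N. subgroup N G \<and> no_inf_divisible (G Mod N)}"

definition inffree :: "('g, 'm) monoid_scheme \<Rightarrow> 'g set monoid" where
  "inffree G = G Mod (inffree_kernel G)"

end

theory Submission
  imports Defs
begin

text \<open>Write \<open>A\<close> for the infinitely-divisible-free quotient of the first homology group. Torsion
  elements are infinitely divisible, so \<open>A\<close> is torsion-free. If cycles with nontrivial image in \<open>A\<close>
  existed in every neighbourhood of some point \<open>x\<close>, local path connectedness would give loops
  \<open>\<gamma> m\<close> at \<open>x\<close>, shrinking to \<open>x\<close>, with classes \<open>a m \<noteq> 0\<close> in \<open>A\<close>. Choose \<open>n m > 0\<close> not dividing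
  \<open>a m\<close>. For each set \<open>S\<close> of naturals an infinitely nested concatenation produces loops whose
  classes satisfy \<open>b m = [m \<in> S] a m + n m * b (m + 1)\<close>; if \<open>b 0\<close> agreed for two sets first
  differing at \<open>m\<close>, cancelling in the torsion-free group would make \<open>a m\<close> divisible by \<open>n m\<close>.
  So \<open>A\<close> would have at least \<open>2\<close> to the \<open>\<aleph>\<^sub>0\<close> elements. Hence every point has a neighbourhood
  whose cycles die in \<open>A\<close>, and a Lebesgue number with subdivision of cycles shows that \<open>A\<close> is
  finitely generated; being torsion-free it is free of finite rank.\<close>

section \<open>Paths and singular chains\<close>

definition path_join :: "(real \<Rightarrow> 'a) \<Rightarrow> (real \<Rightarrow> 'a) \<Rightarrow> real \<Rightarrow> 'a" where
  "path_join f g t = (if t \<le> 1/2 then f (2 * t) else g (2 * t - 1))"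

lemma pathin_path_join:
  assumes f: "pathin X f" and g: "pathin X g" and "f 1 = g 0"
  shows "pathin X (path_join f g)"
proof -
  let ?T01 = "top_of_set {0..1::real}"
  let ?g = "\<lambda>x. if x \<le> 1/2 then (f \<circ> (\<lambda>t. 2 * t)) x else (g \<circ> (\<lambda>t. 2 * t -1)) x"
  have "continuous_map (subtopology euclideanreal {0..1}) X ?g"
  proof (intro continuous_map_cases_le continuous_map_compose, force, force)
    show "continuous_map (subtopology ?T01 {x \<in> topspace ?T01. x \<le> 1/2}) ?T01 ((*) 2)"
      by (auto simp: continuous_map_in_subtopology continuous_map_from_subtopology)
    have "continuous_map (subtopology (top_of_set {0..1}) {x. 0 \<le> x \<and> x \<le> 1 \<and> 1 \<le> x * 2})
             euclideanreal (\<lambda>t. 2 * t - 1)"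
      by (intro continuous_intros) (force intro: continuous_map_from_subtopology)
    then show "continuous_map (subtopology ?T01 {x \<in> topspace ?T01. 1/2 \<le> x}) ?T01 (\<lambda>t. 2 * t - 1)"
      by (force simp: continuous_map_in_subtopology)
    show "(f \<circ> (*) 2) x = (g \<circ> (\<lambda>t. 2 * t - 1)) x" if "x \<in> topspace ?T01" "x = 1/2" for x
      using that assms(3) by (simp add: mult.commute)
  qed (use f g in \<open>auto simp: pathin_def\<close>)
  moreover have "?g = path_join f g"
    by (auto simp: path_join_def)
  ultimately show ?thesis
    by (simp add: pathin_def)
qed

text \<open>Vertex 0 goes to \<open>g a\<close> and vertex 1 to \<open>g b\<close>;
  \<open>a > b\<close> is allowed, so reversed pieces of a path are covered too. The restriction is
  there because singular simplices are extensional functions.\<close>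

definition path_simplex :: "(real \<Rightarrow> 'a) \<Rightarrow> real \<Rightarrow> real \<Rightarrow> (nat \<Rightarrow> real) \<Rightarrow> 'a" where
  "path_simplex g a b = (\<lambda>v\<in>standard_simplex 1. g (a * v 0 + b * v 1))"

abbreviation path_chain :: "(real \<Rightarrow> 'a) \<Rightarrow> 'a chain" where
  "path_chain g \<equiv> frag_of (path_simplex g 0 1)"

definition point_simplex :: "'a \<Rightarrow> (nat \<Rightarrow> real) \<Rightarrow> 'a" where
  "point_simplex y = (\<lambda>v\<in>standard_simplex 0. y)"

section \<open>Low-dimensional simplices\<close>

lemma atMost_1: "{..1::nat} = {0,1}" "{..Suc 0} = {0,1}"
  and atMost_2: "{..2::nat} = {0,1,2}" "{..Suc (Suc 0)} = {0,1,2}"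
  by auto

lemma simplical_face_apply:
  "simplical_face k x i = (if i < k then x i else if i = k then 0 else x (i - 1))"
  by (simp add: simplical_face_def)

lemma standard_simplex_1:
  "v \<in> standard_simplex (Suc 0) \<longleftrightarrow>
     0 \<le> v 0 \<and> 0 \<le> v (Suc 0) \<and> v 0 + v (Suc 0) = 1 \<and> (\<forall>i>Suc 0. v i = 0)"
proof
  assume "0 \<le> v 0 \<and> 0 \<le> v (Suc 0) \<and> v 0 + v (Suc 0) = 1 \<and> (\<forall>i>Suc 0. v i = 0)"
  then have v: "0 \<le> v 0" "0 \<le> v (Suc 0)" "v 0 + v (Suc 0) = 1" "\<And>i. i > Suc 0 \<Longrightarrow> v i = 0"
    by auto
  have "0 \<le> v i \<and> v i \<le> 1" for i
  proof -
    consider "i = 0" | "i = Suc 0" | "i > Suc 0" by linarith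
    then show ?thesis by cases (use v in auto)
  qed
  then show "v \<in> standard_simplex (Suc 0)"
    using v by (auto simp: standard_simplex_def atMost_1)
qed (auto simp: standard_simplex_def atMost_1)

lemma standard_simplex_1_path:
  assumes "v \<in> standard_simplex (Suc 0)"
  shows "v = (\<lambda>i. if i = 0 then 1 - v (Suc 0) else if i = Suc 0 then v (Suc 0) else 0)"
proof
  fix i :: nat
  consider "i = 0" | "i = Suc 0" | "i > Suc 0" by linarith
  then show "v i = (if i = 0 then 1 - v (Suc 0) else if i = Suc 0 then v (Suc 0) else 0)"
    by cases (use assms in \<open>auto simp: standard_simplex_1\<close>)
qed

text \<open>The sum is a convex combination of the weights \<open>w i\<close>, hence stays in the
  unit interval.\<close>

lemma continuous_map_affine_simplex:
  fixes w :: "nat \<Rightarrow> real"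
  assumes "\<And>i. i \<le> p \<Longrightarrow> w i \<in> {0..1}"
  shows "continuous_map (subtopology (powertop_real UNIV) (standard_simplex p)) (top_of_set {0..1})
           (\<lambda>v. \<Sum>i\<le>p. w i * v i)"
proof -
  have "(\<Sum>i\<le>p. w i * v i) \<in> {0..1}" if "v \<in> standard_simplex p" for v
  proof -
    have v: "\<And>i. 0 \<le> v i" "(\<Sum>i\<le>p. v i) = 1"
      using that by (auto simp: standard_simplex_def)
    have "(\<Sum>i\<le>p. w i * v i) \<le> (\<Sum>i\<le>p. v i)"
      by (rule sum_mono) (use assms v in \<open>auto intro: mult_left_le_one_le\<close>)
    moreover have "0 \<le> (\<Sum>i\<le>p. w i * v i)"
      by (rule sum_nonneg) (use assms v in auto)
    ultimately show ?thesis
      using v by auto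
  qed
  moreover have "continuous_map (subtopology (powertop_real UNIV) (standard_simplex p)) euclideanreal
           (\<lambda>v. \<Sum>i\<le>p. w i * v i)"
    by (intro continuous_map_sum continuous_map_real_mult continuous_map_from_subtopology
        continuous_map_product_projection continuous_map_const[THEN iffD2]) auto
  ultimately show ?thesis
    by (auto simp: continuous_map_in_subtopology)
qed

text \<open>Edges and triangles alike factor through the parameter interval, so this one fact makes
  all of them singular simplices.\<close>

lemma singular_simplex_path_affine:
  fixes w :: "nat \<Rightarrow> real"
  assumes "pathin X g" "\<And>i. i \<le> p \<Longrightarrow> w i \<in> {0..1}"
  shows "singular_simplex p X (\<lambda>v\<in>standard_simplex p. g (\<Sum>i\<le>p. w i * v i))"
proof -
  have "continuous_map (subtopology (powertop_real UNIV) (standard_simplex p)) X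
          (g \<circ> (\<lambda>v. \<Sum>i\<le>p. w i * v i))"
    using assms continuous_map_affine_simplex[of p w]
    by (auto simp: pathin_def intro: continuous_map_compose)
  then have "continuous_map (subtopology (powertop_real UNIV) (standard_simplex p)) X
          (\<lambda>v\<in>standard_simplex p. g (\<Sum>i\<le>p. w i * v i))"
    by (rule continuous_map_eq) auto
  then show ?thesis
    by (simp add: singular_simplex_def)
qed

lemma singular_simplex_path_simplex:
  assumes "pathin X g" "a \<in> {0..1}" "b \<in> {0..1}"
  shows "singular_simplex 1 X (path_simplex g a b)"
proof -
  have "singular_simplex 1 X (\<lambda>v\<in>standard_simplex 1. g (\<Sum>i\<le>1. (if i = 0 then a else b) * v i))"
    by (rule singular_simplex_path_affine) (use assms in auto)
  moreover have "(\<lambda>v\<in>standard_simplex 1. g (\<Sum>i\<le>1. (if i = 0 then a else b) * v i)) = path_simplex g a b"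
    unfolding path_simplex_def by (simp add: atMost_1)
  ultimately show ?thesis by metis
qed

lemma singular_face_path_simplex:
  "singular_face 1 0 (path_simplex g a b) = point_simplex (g b)"
  "singular_face 1 1 (path_simplex g a b) = point_simplex (g a)"
proof -
  have "simplical_face k v \<in> standard_simplex 1" if "v \<in> standard_simplex 0" "k \<le> 1" for k v
    using simplical_face_in_standard_simplex[of 1 k v] that by simp
  then show "singular_face 1 0 (path_simplex g a b) = point_simplex (g b)"
    "singular_face 1 1 (path_simplex g a b) = point_simplex (g a)"
    by (auto simp: singular_face_def path_simplex_def point_simplex_def fun_eq_iff
        simplical_face_apply standard_simplex_0)
qed

section \<open>Homology relations between path chains\<close>

lemma chain_boundary_path_simplex:
  "chain_boundary 1 (frag_of (path_simplex g a b)) =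
     frag_of (point_simplex (g b)) - frag_of (point_simplex (g a))"
  unfolding chain_boundary_of using singular_face_path_simplex[of g a b] by (simp add: atMost_1)

text \<open>A triangle folded onto the path, with vertices at the parameters \<open>a\<close>,
  \<open>b\<close>, \<open>c\<close>, has this relation as its boundary. The parameters may come in
  any order, so concatenation, constant paths and reversal all follow from it.\<close>

lemma path_simplex_triangle:
  assumes g: "pathin X g" and abc: "a \<in> {0..1}" "b \<in> {0..1}" "c \<in> {0..1}"
  shows "homologous_rel 1 X {} (frag_of (path_simplex g a b) + frag_of (path_simplex g b c))
           (frag_of (path_simplex g a c))"
proof -
  define w where "w = (\<lambda>i::nat. if i = 0 then a else if i = 1 then b else c)"
  define T where "T = (\<lambda>v\<in>standard_simplex 2. g (\<Sum>i\<le>2. w i * v i))"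
  have "singular_simplex 2 X T"
    unfolding T_def by (rule singular_simplex_path_affine[OF g]) (use abc in \<open>auto simp: w_def\<close>)
  then have T: "singular_chain (Suc 1) X (frag_of T)"
    by (simp add: singular_chain_of numeral_2_eq_2)
  have in2: "simplical_face k v \<in> standard_simplex 2" if "v \<in> standard_simplex 1" "k \<le> 2" for k v
    using simplical_face_in_standard_simplex[of 2 k v] that by simp
  have "singular_face 2 0 T = path_simplex g b c" "singular_face 2 1 T = path_simplex g a c"
       "singular_face 2 2 T = path_simplex g a b"
    using in2
    by (auto simp: singular_face_def path_simplex_def T_def fun_eq_iff w_def atMost_2 simplical_face_apply numeral_2_eq_2 add.assoc)
  then have "chain_boundary (Suc 1) (frag_of T) = frag_of (path_simplex g b c)
      - frag_of (path_simplex g a c) + frag_of (path_simplex g a b)"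
    unfolding chain_boundary_of by (simp add: atMost_2 numeral_2_eq_2)
  then have "chain_boundary (Suc 1) (frag_of T) = frag_of (path_simplex g a b)
      + frag_of (path_simplex g b c) - frag_of (path_simplex g a c)"
    by (simp add: algebra_simps)
  with T show ?thesis
    unfolding homologous_rel_def singular_boundary by blast
qed

text \<open>The triangle relation for the joined path at the parameters 0, 1/2, 1; its two short
  edges are exactly the simplices of \<open>f\<close> and \<open>g\<close>.\<close>

lemma path_chain_join:
  assumes "pathin X f" "pathin X g" "f 1 = g 0"
  shows "homologous_rel 1 X {} (path_chain f + path_chain g) (path_chain (path_join f g))"
proof -
  let ?j = "path_join f g"
  have 1: "path_simplex ?j 0 (1/2) = path_simplex f 0 1"
    by (auto simp: path_simplex_def path_join_def fun_eq_iff dest: standard_simplex_1[THEN iffD1])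
  have 2: "path_simplex ?j (1/2) 1 = path_simplex g 0 1"
  proof -
    have "?j (1/2 * v 0 + 1 * v 1) = g (0 * v 0 + 1 * v 1)" if "v \<in> standard_simplex 1" for v
    proof -
      have v: "v 0 = 1 - v 1" "v 1 \<ge> 0" using that by (auto simp: standard_simplex_1)
      show ?thesis
      proof (cases "v 1 = 0")
        case True
        \<comment> \<open>At \<open>v 1 = 0\<close> the parameter is 1/2, where the join still uses
          \<open>f\<close>, so the two sides match because \<open>f 1 = g 0\<close>.\<close>
        with v assms(3) show ?thesis by (simp add: path_join_def)
      next
        case False
        have e: "1/2 * v 0 + 1 * v 1 = (1 + v 1) / 2"
          using v by (simp add: field_simps)
        have "path_join f g ((1 + v 1) / 2) = g (2 * ((1 + v 1) / 2) - 1)"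
          using v False by (simp add: path_join_def)
        also have "2 * ((1 + v 1) / 2) - 1 = 0 * v 0 + 1 * v 1"
          by (simp add: add_divide_distrib)
        finally show ?thesis unfolding e .
      qed
    qed
    then show ?thesis
      unfolding path_simplex_def by (intro restrict_ext)
  qed
  show ?thesis
    using path_simplex_triangle[OF pathin_path_join[OF assms], of 0 "1/2" 1] unfolding 1 2 by simp
qed

text \<open>The triangle with all parameters 0 makes \<open>c + c\<close> homologous to
  \<open>c\<close>, so \<open>c\<close> bounds.\<close>

lemma path_chain_const:
  assumes "x \<in> topspace X"
  shows "singular_relboundary 1 X {} (path_chain (\<lambda>_. x))"
proof -
  have "path_simplex (\<lambda>_. x) 0 0 = path_simplex (\<lambda>_. x) 0 1"
    by (auto simp: path_simplex_def)
  then show ?thesis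
    using path_simplex_triangle[of X "\<lambda>_. x" 0 0 0] assms by (simp add: homologous_rel_def)
qed

lemma pathin_reverse:
  assumes "pathin X g"
  shows "pathin X (\<lambda>t. g (1 - t))"
proof -
  have "continuous_map (top_of_set {0..1}) (top_of_set {0..1::real}) (\<lambda>t. 1 - t)"
    by (auto intro!: continuous_intros simp: continuous_map_in_subtopology)
  from continuous_map_compose[OF this assms[unfolded pathin_def]] show ?thesis
    by (simp add: pathin_def o_def)
qed

text \<open>The triangle with parameters 0, 1, 0 goes out and back, and its third edge is
  constant.\<close>

lemma path_chain_reverse:
  assumes g: "pathin X g"
  shows "homologous_rel 1 X {} (path_chain (\<lambda>t. g (1 - t))) (- path_chain g)"
proof -
  have 1: "path_chain (\<lambda>t. g (1 - t)) = frag_of (path_simplex g 1 0)"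
    using standard_simplex_1 by (auto simp: path_simplex_def fun_eq_iff frag_of_eq intro!: arg_cong[of _ _ g])
  have 2: "path_simplex g 0 0 = path_simplex (\<lambda>_. g 0) 0 1"
    by (auto simp: path_simplex_def)
  have "homologous_rel 1 X {} (path_chain g + path_chain (\<lambda>t. g (1 - t))) (path_chain (\<lambda>_. g 0))"
    using path_simplex_triangle[OF g, of 0 1 0] unfolding 1 2 by simp
  moreover have "homologous_rel 1 X {} (path_chain (\<lambda>_. g 0)) 0"
    using path_chain_const[OF path_start_in_topspace[OF g]] by (simp add: homologous_rel_def)
  ultimately have "homologous_rel 1 X {} (path_chain g + path_chain (\<lambda>t. g (1 - t))) 0"
    using homologous_rel_trans by blast
  then show ?thesis
    by (simp add: homologous_rel_def add.commute)
qed

text \<open>Composition with the affine parametrisation of the 1-simplex yields the path. Arguments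
  about 1-chains can therefore be carried out on paths.\<close>

lemma singular_simplex_1_eq_path_simplex:
  assumes "singular_simplex 1 X \<sigma>"
  obtains g where "pathin X g" "\<sigma> = path_simplex g 0 1"
proof -
  define e where "e = (\<lambda>t i. if i = 0 then 1 - t else if i = Suc 0 then t else (0::real))"
  define g where "g = \<sigma> \<circ> e"
  have 1: "continuous_map (top_of_set {0..1}) (subtopology (powertop_real UNIV) (standard_simplex 1)) e"
    unfolding continuous_map_in_subtopology continuous_map_componentwise_UNIV
  proof (intro conjI allI)
    show "continuous_map (top_of_set {0..1}) euclideanreal (\<lambda>x. e x k)" for k
      unfolding e_def by (cases "k = 0"; cases "k = Suc 0") (auto intro!: continuous_intros)
    show "e \<in> topspace (top_of_set {0..1}) \<rightarrow> standard_simplex 1"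
      by (auto simp: e_def standard_simplex_def atMost_1)
  qed
  have "pathin X g"
    unfolding g_def pathin_def
    by (rule continuous_map_compose[OF 1]) (use assms in \<open>auto simp: singular_simplex_def\<close>)
  moreover have "\<sigma> = path_simplex g 0 1"
  proof
    fix v
    show "\<sigma> v = path_simplex g 0 1 v"
    proof (cases "v \<in> standard_simplex (Suc 0)")
      case True
      then have "v = e (v 1)"
        using standard_simplex_1_path[OF True] by (simp add: e_def)
      with True show ?thesis by (simp add: path_simplex_def g_def)
    next
      case False
      then show ?thesis using assms by (auto simp: path_simplex_def singular_simplex_def extensional_def)
    qed
  qed
  ultimately show thesis using that by blast
qed

lemma chain_boundary_path_chain:
  "chain_boundary 1 (path_chain g) = frag_of (point_simplex (g 1)) - frag_of (point_simplex (g 0))"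
  by (rule chain_boundary_path_simplex)

lemma singular_chain_path_chain: "pathin X g \<Longrightarrow> singular_chain 1 X (path_chain g)"
  by (simp add: singular_chain_of singular_simplex_path_simplex del: One_nat_def)

lemma singular_cycle_loop:
  "pathin X g \<Longrightarrow> g 0 = g 1 \<Longrightarrow> singular_relcycle 1 X {} (path_chain g)"
  using singular_chain_path_chain[of X g] chain_boundary_path_chain[of g]
  unfolding singular_cycle by simp

section \<open>Infinitely nested loops\<close>

definition loop_at :: "'a topology \<Rightarrow> 'a \<Rightarrow> (real \<Rightarrow> 'a) \<Rightarrow> bool" where
  "loop_at X x g \<longleftrightarrow> pathin X g \<and> g 0 = x \<and> g 1 = x"

lemma loop_at_const: "x \<in> topspace X \<Longrightarrow> loop_at X x (\<lambda>_. x)"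
  by (simp add: loop_at_def)

lemma loop_at_path_join: "loop_at X x f \<Longrightarrow> loop_at X x g \<Longrightarrow> loop_at X x (path_join f g)"
  by (auto simp: loop_at_def pathin_path_join) (auto simp: path_join_def)

primrec loop_power :: "'a \<Rightarrow> (real \<Rightarrow> 'a) \<Rightarrow> nat \<Rightarrow> real \<Rightarrow> 'a" where
  "loop_power x g 0 = (\<lambda>_. x)"
| "loop_power x g (Suc n) = path_join g (loop_power x g n)"

lemma loop_at_loop_power: "loop_at X x g \<Longrightarrow> x \<in> topspace X \<Longrightarrow> loop_at X x (loop_power x g n)"
  by (induction n) (auto simp: loop_at_const loop_at_path_join)

lemma path_chain_loop_power:
  assumes g: "loop_at X x g" and x: "x \<in> topspace X"
  shows "homologous_rel 1 X {} (path_chain (loop_power x g n)) (frag_cmul (int n) (path_chain g))"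
proof (induction n)
  case 0
  then show ?case
    using path_chain_const[OF x] by (simp add: homologous_rel_def)
next
  case (Suc n)
  have "homologous_rel 1 X {} (path_chain (loop_power x g (Suc n)))
          (path_chain g + path_chain (loop_power x g n))"
    using path_chain_join[of X g "loop_power x g n"] g loop_at_loop_power[OF g x, of n]
      homologous_rel_sym[of 1 X "{}"] by (simp add: loop_at_def)
  moreover have "homologous_rel 1 X {} (path_chain g + path_chain (loop_power x g n))
      (path_chain g + frag_cmul (int n) (path_chain g))"
    by (intro homologous_rel_add Suc homologous_rel_refl)
  moreover have "path_chain g + frag_cmul (int n) (path_chain g) = frag_cmul (int (Suc n)) (path_chain g)"
    by (simp add: frag_cmul_distrib)
  ultimately show ?case
    using homologous_rel_trans by metis
qed

text \<open>Replaces uniform closeness: \<open>g\<close> may insert excursions where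
  \<open>f\<close> rests at the base point. The relation survives concatenation and powers, with no
  metric involved.\<close>

definition agree_up_to :: "'a \<Rightarrow> 'a set \<Rightarrow> (real \<Rightarrow> 'a) \<Rightarrow> (real \<Rightarrow> 'a) \<Rightarrow> bool" where
  "agree_up_to x V f g \<longleftrightarrow> (\<forall>t\<in>{0..1}. g t = f t \<or> f t = x \<and> g t \<in> V)"

lemma agree_up_to_path_join:
  assumes "agree_up_to x V f f'" "agree_up_to x V g g'"
  shows "agree_up_to x V (path_join f g) (path_join f' g')"
proof -
  have "2 * t \<in> {0..1}" if "t \<in> {0..1}" "t \<le> 1/2" for t :: real using that by auto
  moreover have "2 * t - 1 \<in> {0..1}" if "t \<in> {0..1}" "\<not> t \<le> 1/2" for t :: real using that by auto
  ultimately show ?thesis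
    using assms unfolding agree_up_to_def path_join_def by presburger
qed

lemma agree_up_to_loop_power:
  "agree_up_to x V g g' \<Longrightarrow> agree_up_to x V (loop_power x g n) (loop_power x g' n)"
  by (induction n) (auto simp: agree_up_to_path_join, simp add: agree_up_to_def)

text \<open>Pointwise convergence with discrete values. Such limits are unique and commute with
  concatenation without any appeal to the topology of the space.\<close>

definition eventually_agree :: "(nat \<Rightarrow> real \<Rightarrow> 'a) \<Rightarrow> (real \<Rightarrow> 'a) \<Rightarrow> bool" where
  "eventually_agree F g \<longleftrightarrow> (\<forall>t\<in>{0..1}. \<forall>\<^sub>F k in sequentially. F k t = g t)"

lemma eventually_agree_const: "eventually_agree (\<lambda>_. g) g"
  by (simp add: eventually_agree_def)

lemma eventually_agree_path_join:
  assumes "eventually_agree F f" "eventually_agree G g"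
  shows "eventually_agree (\<lambda>k. path_join (F k) (G k)) (path_join f g)"
  using assms by (auto simp: eventually_agree_def path_join_def)

lemma eventually_agree_loop_power:
  "eventually_agree G g \<Longrightarrow> eventually_agree (\<lambda>k. loop_power x (G k) n) (loop_power x g n)"
  by (induction n) (auto simp: eventually_agree_path_join eventually_agree_const)

lemma eventually_agree_unique:
  assumes "eventually_agree F f" "eventually_agree F g" "t \<in> {0..1}"
  shows "f t = g t"
proof -
  have "\<forall>\<^sub>F k in sequentially. F k t = f t" "\<forall>\<^sub>F k in sequentially. F k t = g t"
    using assms by (auto simp: eventually_agree_def)
  then have "\<forall>\<^sub>F k in sequentially. f t = g t"
    by eventually_elim simp
  then show ?thesis by simp
qed

text \<open>Away from the base point the limit agrees locally with one of the approximating paths, so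
  no metric estimate is needed for its continuity.\<close>

lemma pathin_limit:
  assumes X: "t1_space X" "x \<in> topspace X"
    and F: "\<And>k. pathin X (F k)"
    and V: "\<And>W. openin X W \<Longrightarrow> x \<in> W \<Longrightarrow> \<exists>k. V k \<subseteq> W"
    and agree: "\<And>k. agree_up_to x (V k) (F k) g"
  shows "pathin X g"
proof -
  let ?I = "top_of_set {0..1::real}"
  have F_open: "openin ?I {t \<in> {0..1}. F k t \<in> W}" if "openin X W" for k W
    using F[of k] that by (auto simp: pathin_def continuous_map)
  have F_top: "F k t \<in> topspace X" if "t \<in> {0..1}" for k t
    using F[of k] that by (auto simp: pathin_def continuous_map)
  have ag: "g t = F k t \<or> F k t = x \<and> g t \<in> V k" if "t \<in> {0..1}" for k t
    using agree[of k] that unfolding agree_up_to_def by blast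
  have loc: "\<exists>N. openin ?I N \<and> t \<in> N \<and> N \<subseteq> {s \<in> {0..1}. g s \<in> W}"
    if W: "openin X W" and t: "t \<in> {0..1}" "g t \<in> W" for W t
  proof (cases "g t = x")
    case True
    then obtain k where k: "V k \<subseteq> W" using V W t by metis
    show ?thesis
    proof (intro exI conjI)
      show "openin ?I {s \<in> {0..1}. F k s \<in> W}" by (rule F_open[OF W])
      show "t \<in> {s \<in> {0..1}. F k s \<in> W}"
        using ag[OF t(1), of k] t True by auto
      show "{s \<in> {0..1}. F k s \<in> W} \<subseteq> {s \<in> {0..1}. g s \<in> W}"
        using ag[of _ k] k by force
    qed
  next
    case False
    have 1: "openin X (topspace X - {g t})" "openin X (W - {x})"
      using X W closedin_t1_singleton[OF X(1)] openin_subset[OF W] t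
      by (auto intro!: openin_diff)
    \<comment> \<open>A small \<open>V k\<close> misses \<open>g t\<close>, which leaves only
      \<open>g t = F k t\<close>. Near \<open>t\<close> the path \<open>F k\<close> avoids
      \<open>x\<close>, and this forces \<open>g = F k\<close> there.\<close>
    obtain k where k: "V k \<subseteq> topspace X - {g t}"
      using V[OF 1(1)] False X by auto
    show ?thesis
    proof (intro exI conjI)
      show "openin ?I {s \<in> {0..1}. F k s \<in> W - {x}}" by (rule F_open[OF 1(2)])
      show "t \<in> {s \<in> {0..1}. F k s \<in> W - {x}}"
        using ag[OF t(1), of k] t False k by auto
      show "{s \<in> {0..1}. F k s \<in> W - {x}} \<subseteq> {s \<in> {0..1}. g s \<in> W}"
        using ag[of _ k] by force
    qed
  qed
  obtain k where k: "V k \<subseteq> topspace X"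
    using V[of "topspace X"] X by blast
  have "g t \<in> topspace X" if "t \<in> {0..1}" for t
    using ag[OF that, of k] k F_top[OF that, of k] by auto
  moreover have "openin ?I {t \<in> {0..1}. g t \<in> W}" if "openin X W" for W
    by (subst openin_subopen) (use loc[OF that] in auto)
  ultimately show ?thesis
    by (auto simp: pathin_def continuous_map)
qed

text \<open>The \<open>k\<close>-th approximation to the infinitely nested loop that solves
  \<open>\<beta> m = \<gamma> m \<cdot> (\<beta> (m + 1)) ^ n m\<close> stays at the base point inside the \<open>k\<close>-th nesting level.\<close>

primrec nested_approx ::
    "'a \<Rightarrow> (nat \<Rightarrow> real \<Rightarrow> 'a) \<Rightarrow> (nat \<Rightarrow> nat) \<Rightarrow> nat \<Rightarrow> nat \<Rightarrow> real \<Rightarrow> 'a" where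
  "nested_approx x \<gamma> n 0 m = (\<lambda>_. x)"
| "nested_approx x \<gamma> n (Suc k) m =
     path_join (\<gamma> m) (loop_power x (nested_approx x \<gamma> n k (Suc m)) (n m))"

lemma path_join_mem:
  assumes "\<And>t. t \<in> {0..1} \<Longrightarrow> f t \<in> V" "\<And>t. t \<in> {0..1} \<Longrightarrow> g t \<in> V" "t \<in> {0..1}"
  shows "path_join f g t \<in> V"
  using assms by (auto simp: path_join_def)

lemma loop_power_mem:
  "(\<And>t. t \<in> {0..1} \<Longrightarrow> g t \<in> V) \<Longrightarrow> x \<in> V \<Longrightarrow> t \<in> {0..1} \<Longrightarrow> loop_power x g n t \<in> V"
  by (induction n arbitrary: t) (auto intro!: path_join_mem)

text \<open>Later approximations change an earlier one only where it rests at \<open>x\<close>, and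
  only inside ever smaller sets \<open>U\<close>. Hence they converge to a continuous limit, and
  their recursion passes to it.\<close>

lemma nested_loops_exist:
  assumes X: "t1_space X" "x \<in> topspace X"
    and U: "\<And>m. x \<in> U m" "\<And>m. U (Suc m) \<subseteq> U m"
    and base: "\<And>W. openin X W \<Longrightarrow> x \<in> W \<Longrightarrow> \<exists>m. U m \<subseteq> W"
    and \<gamma>: "\<And>m. loop_at X x (\<gamma> m)" "\<And>m t. t \<in> {0..1} \<Longrightarrow> \<gamma> m t \<in> U m"
  obtains \<beta> where "\<And>m. loop_at X x (\<beta> m)"
    "\<And>m t. t \<in> {0..1} \<Longrightarrow> \<beta> m t = path_join (\<gamma> m) (loop_power x (\<beta> (Suc m)) (n m)) t"
proof -
  define B where "B = nested_approx x \<gamma> n"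
  have B_0: "B 0 m = (\<lambda>_. x)" and
    B_Suc: "B (Suc k) m = path_join (\<gamma> m) (loop_power x (B k (Suc m)) (n m))" for k m
    by (simp_all add: B_def)
  have decr: "U (m + k) \<subseteq> U m" for m k
    by (induction k) (use U(2) in auto)
  have B_loop: "loop_at X x (B k m)" for k m
    by (induction k arbitrary: m)
      (auto simp: B_0 B_Suc X loop_at_const \<gamma> intro!: loop_at_path_join loop_at_loop_power)
  have B_mem: "B k m t \<in> U m" if "t \<in> {0..1}" for k m t
    using that
  proof (induction k arbitrary: m t)
    case (Suc k)
    have "B k (Suc m) s \<in> U m" if "s \<in> {0..1}" for s
      using Suc.IH[OF that, of "Suc m"] U(2) by auto
    then show ?case
      unfolding B_Suc by (intro path_join_mem[OF \<gamma>(2) loop_power_mem] Suc.prems U)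
  qed (simp add: B_0 U)
  have B_agree: "agree_up_to x (U (m + k)) (B k m) (B (k + j) m)" for k j m
  proof (induction k arbitrary: m)
    case 0
    then show ?case by (simp add: agree_up_to_def B_0 B_mem)
  next
    case (Suc k)
    \<comment> \<open>The outer loop is common to both sides; the inner one lies one level deeper
      with one step fewer, and \<open>m + Suc k = Suc m + k\<close>.\<close>
    have "agree_up_to x (U (m + Suc k)) (\<gamma> m) (\<gamma> m)"
      by (simp add: agree_up_to_def)
    with Suc[of "Suc m"] show ?case
      by (auto simp: B_Suc intro!: agree_up_to_path_join agree_up_to_loop_power)
  qed
  \<comment> \<open>Once an approximation leaves \<open>x\<close> at \<open>t\<close>, its value
    there is final, so the first value other than \<open>x\<close> is the limit; if there is none,
    the limit is \<open>x\<close>.\<close>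
  define \<beta> where "\<beta> = (\<lambda>m t. if \<exists>k. B k m t \<noteq> x then B (LEAST k. B k m t \<noteq> x) m t else x)"
  have ev: "eventually_agree (\<lambda>k. B k m) (\<beta> m)" for m
    unfolding eventually_agree_def
  proof
    fix t :: real assume t: "t \<in> {0..1}"
    show "\<forall>\<^sub>F k in sequentially. B k m t = \<beta> m t"
    proof (cases "\<exists>k. B k m t \<noteq> x")
      case True
      define l where "l = (LEAST k. B k m t \<noteq> x)"
      have l: "B l m t \<noteq> x" unfolding l_def using True by (rule LeastI_ex)
      have "B k m t = B l m t" if "k \<ge> l" for k
        using B_agree[of m l "k - l"] that t l by (auto simp: agree_up_to_def)
      moreover have "\<beta> m t = B l m t" using True by (simp add: \<beta>_def l_def)
      ultimately show ?thesis
        unfolding eventually_sequentially by metis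
    qed (simp add: \<beta>_def)
  qed
  have \<beta>_agree: "agree_up_to x (U (m + k)) (B k m) (\<beta> m)" for m k
    unfolding agree_up_to_def
  proof
    fix t :: real assume t: "t \<in> {0..1}"
    then have "\<forall>\<^sub>F j in sequentially. B j m t = \<beta> m t"
      using ev by (simp add: eventually_agree_def)
    then obtain N where "\<And>j. j \<ge> N \<Longrightarrow> B j m t = \<beta> m t"
      unfolding eventually_sequentially by blast
    then obtain j where "j \<ge> k" "B j m t = \<beta> m t"
      using max.cobounded1 max.cobounded2 by metis
    with B_agree[of m k "j - k"] t show "\<beta> m t = B k m t \<or> B k m t = x \<and> \<beta> m t \<in> U (m + k)"
      unfolding agree_up_to_def by (metis le_add_diff_inverse)
  qed
  have base': "\<exists>k. U (m + k) \<subseteq> W" if "openin X W" "x \<in> W" for W m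
  proof -
    obtain k where "U k \<subseteq> W" using base \<open>openin X W\<close> \<open>x \<in> W\<close> by blast
    with decr[of k m] have "U (m + k) \<subseteq> W" by (metis add.commute subset_trans)
    then show ?thesis ..
  qed
  have "B k m 0 = x" "B k m 1 = x" for k m
    using B_loop[of k m] by (simp_all add: loop_at_def)
  then have "\<beta> m 0 = x" "\<beta> m 1 = x" for m
    by (simp_all add: \<beta>_def)
  moreover have "pathin X (\<beta> m)" for m
  proof (rule pathin_limit[OF X])
    show "pathin X (B k m)" for k
      using B_loop[of k m] by (simp add: loop_at_def)
    show "agree_up_to x (U (m + k)) (B k m) (\<beta> m)" for k
      by (rule \<beta>_agree)
    show "\<exists>k. U (m + k) \<subseteq> W" if "openin X W" "x \<in> W" for W
      by (rule base'[OF that])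
  qed
  ultimately have "loop_at X x (\<beta> m)" for m
    by (simp add: loop_at_def)
  moreover have "\<beta> m t = path_join (\<gamma> m) (loop_power x (\<beta> (Suc m)) (n m)) t" if "t \<in> {0..1}" for m t
  proof (rule eventually_agree_unique[OF _ _ that])
    \<comment> \<open>The shift by one makes \<open>B_Suc\<close> applicable and leaves the limit
      unchanged.\<close>
    show "eventually_agree (\<lambda>k. B (Suc k) m) (\<beta> m)"
      using ev[of m] eventually_sequentially_Suc[of "\<lambda>k. B k m t = \<beta> m t" for t]
      unfolding eventually_agree_def by blast
    show "eventually_agree (\<lambda>k. B (Suc k) m) (path_join (\<gamma> m) (loop_power x (\<beta> (Suc m)) (n m)))"
      unfolding B_Suc
      by (intro eventually_agree_path_join eventually_agree_const eventually_agree_loop_power ev)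
  qed
  ultimately show thesis using that by blast
qed

text \<open>The nested equation read in homology, where concatenation becomes a sum and the power a
  multiple.\<close>

corollary nested_loop_chains_exist:
  assumes X: "t1_space X" "x \<in> topspace X"
    and U: "\<And>m. x \<in> U m" "\<And>m. U (Suc m) \<subseteq> U m"
    and base: "\<And>W. openin X W \<Longrightarrow> x \<in> W \<Longrightarrow> \<exists>m. U m \<subseteq> W"
    and \<gamma>: "\<And>m. loop_at X x (\<gamma> m)" "\<And>m t. t \<in> {0..1} \<Longrightarrow> \<gamma> m t \<in> U m"
  obtains \<beta> where "\<And>m. loop_at X x (\<beta> m)"
    "\<And>m. homologous_rel 1 X {} (path_chain (\<beta> m))
            (path_chain (\<gamma> m) + frag_cmul (int (n m)) (path_chain (\<beta> (Suc m))))"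
proof -
  obtain \<beta> where \<beta>: "\<And>m. loop_at X x (\<beta> m)"
    "\<And>m t. t \<in> {0..1} \<Longrightarrow> \<beta> m t = path_join (\<gamma> m) (loop_power x (\<beta> (Suc m)) (n m)) t"
    using nested_loops_exist[where n = n, OF assms] by blast
  show thesis
  proof (rule that[OF \<beta>(1)])
    fix m
    let ?p = "loop_power x (\<beta> (Suc m)) (n m)"
    have p: "loop_at X x ?p" by (intro loop_at_loop_power \<beta> X)
    \<comment> \<open>A path simplex sees only parameters in the unit interval, so agreement there
      gives equality of the simplices themselves.\<close>
    have eq: "path_simplex (\<beta> m) 0 1 = path_simplex (path_join (\<gamma> m) ?p) 0 1"
      unfolding path_simplex_def using standard_simplex_01[of 1]
      by (intro restrict_ext) (auto intro!: \<beta>(2))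
    have 1: "homologous_rel 1 X {} (path_chain (path_join (\<gamma> m) ?p)) (path_chain (\<gamma> m) + path_chain ?p)"
      using path_chain_join[of X "\<gamma> m" ?p] p \<gamma>(1)[of m] by (simp add: homologous_rel_sym loop_at_def)
    have 2: "homologous_rel 1 X {} (path_chain (\<gamma> m) + path_chain ?p)
        (path_chain (\<gamma> m) + frag_cmul (int (n m)) (path_chain (\<beta> (Suc m))))"
      by (intro homologous_rel_add homologous_rel_refl path_chain_loop_power \<beta> X)
    show "homologous_rel 1 X {} (path_chain (\<beta> m))
            (path_chain (\<gamma> m) + frag_cmul (int (n m)) (path_chain (\<beta> (Suc m))))"
      unfolding eq by (rule homologous_rel_trans[OF 2 1])
  qed
qed

section \<open>Infinitely divisible elements\<close>

text \<open>A torsion element \<open>x\<close> killed by \<open>n\<close> is its own root of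
  exponent \<open>n * k + 1\<close> for every \<open>k\<close>, hence infinitely divisible.\<close>

lemma (in comm_group) no_inf_divisible_torsion_free:
  assumes G: "no_inf_divisible G" and x: "x \<in> carrier G" and n: "0 < n" "x [^] (n::nat) = \<one>"
  shows "x = \<one>"
proof -
  have "x [^] (n * k + 1) = x" for k
    using x n by (simp add: nat_pow_pow[symmetric])
  then have "\<exists>b\<in>carrier G. b [^] (n * k + 1) = x" for k
    using x by blast
  then have "range (\<lambda>k. n * k + 1) \<subseteq> {m. 0 < m \<and> (\<exists>b\<in>carrier G. b [^] m = x)}"
    by (simp add: image_subset_iff)
  moreover have "infinite (range (\<lambda>k. n * k + 1))"
    using n by (intro range_inj_infinite) (auto simp: inj_on_def)
  ultimately have "inf_divisible G x"
    unfolding inf_divisible_def using infinite_super by blast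
  with G x show ?thesis by (simp add: no_inf_divisible_def)
qed

text \<open>Only finitely many positive integers divide a nontrivial element. The non-divisors found
  here become the exponents of the nested loops.\<close>

lemma no_inf_divisible_non_divisor:
  assumes "no_inf_divisible G" "x \<in> carrier G" "x \<noteq> \<one>\<^bsub>G\<^esub>"
  obtains n :: nat where "0 < n" "\<And>b. b \<in> carrier G \<Longrightarrow> b [^]\<^bsub>G\<^esub> n \<noteq> x"
proof -
  have "finite {n::nat. 0 < n \<and> (\<exists>b\<in>carrier G. b [^]\<^bsub>G\<^esub> n = x)}"
    using assms by (auto simp: no_inf_divisible_def inf_divisible_def)
  moreover have "infinite {n::nat. 0 < n}"
    by (metis infinite_Ioi greaterThan_def)
  ultimately have "\<not> {n::nat. 0 < n} \<subseteq> {n::nat. 0 < n \<and> (\<exists>b\<in>carrier G. b [^]\<^bsub>G\<^esub> n = x)}"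
    using finite_subset by blast
  then show thesis using that by blast
qed

lemma (in comm_group) nat_pow_inv_mult:
  assumes "y \<in> carrier G" "z \<in> carrier G"
  shows "(z \<otimes> inv y) [^] (n::nat) = z [^] n \<otimes> inv (y [^] n)"
  using assms by (simp add: nat_pow_distrib nat_pow_inv)

lemma (in group) mult_inv_eq_one_imp_eq:
  assumes "y \<otimes> inv z = \<one>" "y \<in> carrier G" "z \<in> carrier G"
  shows "y = z"
  using inv_equality[OF assms(1)] assms(2,3) by simp

text \<open>Equality propagates from level \<open>m\<close> to \<open>Suc m\<close>: if
  \<open>m\<close> lay in just one of the two sets, \<open>a m\<close> would be an
  \<open>n m\<close>-th power; otherwise \<open>a m\<close> cancels, and torsion-freeness makes
  \<open>n m\<close>-th roots unique. So sets with the same value at level 0 agree at every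
  index.\<close>

lemma (in comm_group) nested_sums_inj:
  fixes n :: "nat \<Rightarrow> nat" and b :: "nat set \<Rightarrow> nat \<Rightarrow> 'a"
  assumes G: "no_inf_divisible G"
    and a: "\<And>m. a m \<in> carrier G"
    and n: "\<And>m. 0 < n m" "\<And>m y. y \<in> carrier G \<Longrightarrow> y [^] n m \<noteq> a m"
    and b: "\<And>S m. b S m \<in> carrier G"
    and b_rec: "\<And>S m. b S m = (if m \<in> S then a m else \<one>) \<otimes> b S (Suc m) [^] n m"
  shows "inj (\<lambda>S. b S 0)"
proof
  fix S T assume eq0: "b S 0 = b T 0"
  have no: "False" if "a m \<otimes> y [^] n m = z [^] n m" "y \<in> carrier G" "z \<in> carrier G" for m y z
  proof -
    have "(z \<otimes> inv y) [^] n m = a m"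
      using that a[of m] nat_pow_inv_mult[OF that(2,3)] by (metis inv_solve_right' nat_pow_closed)
    with n(2) that show False by blast
  qed
  have step: "(m \<in> S \<longleftrightarrow> m \<in> T) \<and> b S (Suc m) = b T (Suc m)" if "b S m = b T m" for m
  proof -
    have 1: "(if m \<in> S then a m else \<one>) \<otimes> b S (Suc m) [^] n m = (if m \<in> T then a m else \<one>) \<otimes> b T (Suc m) [^] n m"
      using that b_rec by metis
    then have 2: "m \<in> S \<longleftrightarrow> m \<in> T"
      using no[OF _ b b, of m S "Suc m" T "Suc m"] no[OF _ b b, of m T "Suc m" S "Suc m"] b
      by (auto split: if_splits)
    with 1 have "b S (Suc m) [^] n m = b T (Suc m) [^] n m"
      using a b by (auto split: if_splits)
    then have "(b S (Suc m) \<otimes> inv (b T (Suc m))) [^] n m = \<one>"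
      using b by (simp add: nat_pow_inv_mult)
    from no_inf_divisible_torsion_free[OF G _ n(1) this]
    have "b S (Suc m) \<otimes> inv (b T (Suc m)) = \<one>"
      using b by simp
    with 2 show ?thesis
      using b mult_inv_eq_one_imp_eq by blast
  qed
  have "b S m = b T m" for m
  proof (induction m)
    case (Suc m)
    then show ?case using step by blast
  qed (rule eq0)
  with step show "S = T" by blast
qed

section \<open>The quotient without infinitely divisible elements\<close>

lemma (in comm_group) coset_nat_pow:
  assumes "subgroup N G" "b \<in> carrier G"
  shows "(N #> b) [^]\<^bsub>G Mod N\<^esub> (n::nat) = N #> (b [^] n)"
proof -
  have "N \<lhd> G" using assms(1) normal_iff_subgroup by blast
  then show ?thesis
    using hom_nat_pow[OF normal.r_coset_hom_Mod assms(2) is_group normal.factorgroup_is_group, of N n]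
    by simp
qed

text \<open>An infinitely divisible coset of the intersection stays infinitely divisible in each
  quotient \<open>G Mod N\<close> of the family, so its representative lies in every
  \<open>N\<close> and hence in the intersection. The smallest subgroup is thus attained.\<close>

lemma (in comm_group)
  shows subgroup_inffree_kernel: "subgroup (inffree_kernel G) G"
    and no_inf_divisible_inffree: "no_inf_divisible (inffree G)"
proof -
  let ?\<N> = "{N. subgroup N G \<and> no_inf_divisible (G Mod N)}"
  define K where "K = inffree_kernel G"
  \<comment> \<open>The whole group belongs to the family, its quotient being trivial, so the
    intersection is over a nonempty family.\<close>
  have "N #> a = carrier G" if "N = carrier G" "a \<in> carrier G" for N a
    using coset_join2[OF that(2) subgroup_self] that by simp
  then have "no_inf_divisible (G Mod carrier G)"
    by (auto simp: no_inf_divisible_def carrier_FactGroup)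
  then have "carrier G \<in> ?\<N>" using subgroup_self by simp
  then have K: "subgroup K G"
    unfolding K_def inffree_kernel_def by (intro subgroups_Inter) auto
  then show "subgroup (inffree_kernel G) G" by (simp add: K_def)
  have coset_trivial: "N #> a = N" if N: "N \<in> ?\<N>" and a: "a \<in> carrier G" "inf_divisible (G Mod K) (K #> a)" for N a
  proof -
    have sN: "subgroup N G" using N by simp
    have KN: "K \<subseteq> N" using N by (auto simp: K_def inffree_kernel_def)
    \<comment> \<open>As \<open>K\<close> is contained in \<open>N\<close>, an \<open>n\<close>-th
      root modulo \<open>K\<close> is also one modulo \<open>N\<close>.\<close>
    have "\<exists>y\<in>carrier (G Mod N). y [^]\<^bsub>G Mod N\<^esub> n = N #> a"
      if ex: "\<exists>y\<in>carrier (G Mod K). y [^]\<^bsub>G Mod K\<^esub> n = K #> a" for n :: nat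
    proof -
      obtain b where b: "b \<in> carrier G" "(K #> b) [^]\<^bsub>G Mod K\<^esub> n = K #> a"
        using ex unfolding carrier_FactGroup by blast
      then have "K #> (b [^] n) = K #> a"
        using coset_nat_pow[OF K b(1)] by simp
      then have "a \<in> K #> (b [^] n)"
        using rcos_self[OF a(1) K] by simp
      then have "a \<in> N #> (b [^] n)"
        using KN by (auto simp: r_coset_def)
      then have "N #> (b [^] n) = N #> a"
        using b(1) sN by (intro repr_independence) auto
      then show ?thesis
        using b(1) coset_nat_pow[OF sN b(1)] by (intro bexI[of _ "N #> b"]) (auto simp: carrier_FactGroup)
    qed
    then have "{n::nat. 0 < n \<and> (\<exists>y\<in>carrier (G Mod K). y [^]\<^bsub>G Mod K\<^esub> n = K #> a)}
        \<subseteq> {n::nat. 0 < n \<and> (\<exists>y\<in>carrier (G Mod N). y [^]\<^bsub>G Mod N\<^esub> n = N #> a)}"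
      by blast
    then have "inf_divisible (G Mod N) (N #> a)"
      using a(2) unfolding inf_divisible_def using infinite_super by blast
    then show ?thesis
      using N a(1) unfolding no_inf_divisible_def by (simp add: carrier_FactGroup)
  qed
  have "K #> a = K" if a: "a \<in> carrier G" "inf_divisible (G Mod K) (K #> a)" for a
  proof -
    have "a \<in> N" if N: "N \<in> ?\<N>" for N
      using coset_join1[OF coset_trivial[OF N a] a(1)] N by simp
    then have "a \<in> K"
      unfolding K_def inffree_kernel_def by blast
    then show ?thesis by (rule coset_join2[OF a(1) K])
  qed
  then have "no_inf_divisible (G Mod K)"
    unfolding no_inf_divisible_def carrier_FactGroup one_FactGroup by blast
  then show "no_inf_divisible (inffree G)"
    by (simp add: inffree_def K_def)
qed

section \<open>Finitely generated torsion-free abelian groups\<close>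

text \<open>The elementary matrix with off-diagonal entry \<open>s\<close> in row \<open>i\<close>
  and column \<open>j\<close>, acting on coefficient vectors. For distinct \<open>i\<close> and
  \<open>j\<close> it is an automorphism and serves as a change of basis.\<close>

definition transvection :: "'i \<Rightarrow> 'i \<Rightarrow> int \<Rightarrow> ('i \<Rightarrow>\<^sub>0 int) \<Rightarrow> 'i \<Rightarrow>\<^sub>0 int" where
  "transvection i j s c = c + frag_cmul (s * Poly_Mapping.lookup c j) (frag_of i)"

lemma lookup_transvection:
  "Poly_Mapping.lookup (transvection i j s c) k =
     Poly_Mapping.lookup c k + (if k = i then s * Poly_Mapping.lookup c j else 0)"
  by (simp add: transvection_def lookup_add)

lemma transvection_add: "transvection i j s (a + b) = transvection i j s a + transvection i j s b"
  by (rule poly_mapping_eqI) (simp add: lookup_transvection lookup_add algebra_simps)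

lemma transvection_inverse: "i \<noteq> j \<Longrightarrow> transvection i j (- s) (transvection i j s c) = c"
  by (rule poly_mapping_eqI) (simp add: lookup_transvection)

lemma keys_transvection:
  assumes "Poly_Mapping.keys c \<subseteq> S" "i \<in> S"
  shows "Poly_Mapping.keys (transvection i j s c) \<subseteq> S"
proof -
  have "Poly_Mapping.keys (transvection i j s c) \<subseteq> Poly_Mapping.keys c \<union> {i}"
    by (auto simp: in_keys_iff lookup_transvection split: if_splits)
  then show ?thesis using assms by blast
qed

lemma (in group) int_pow_eq_one_imp_nat_pow:
  assumes x: "x \<in> carrier G" and "x [^] (m::int) = \<one>"
  shows "x [^] nat \<bar>m\<bar> = \<one>"
proof (cases m rule: int_cases2)
  case (nonneg n)
  with assms(2) show ?thesis by (simp add: int_pow_int)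
next
  case (nonpos n)
  with assms have "inv (x [^] n) = \<one>"
    using int_pow_neg_int[OF x, of n] by simp
  with x nonpos show ?thesis
    using inv_equality[of "\<one>" "x [^] n"] inv_inv[of "x [^] n"] by simp
qed

text \<open>A preimage can be corrected by a multiple of the generator \<open>i\<close>, whose image
  is trivial, until its coefficient at \<open>i\<close> vanishes.\<close>

lemma (in comm_group) free_epi_drop_generator:
  assumes \<phi>: "\<phi> \<in> hom (free_Abelian_group S) G" "carrier G \<subseteq> \<phi> ` carrier (free_Abelian_group S)"
    and i: "i \<in> S" "\<phi> (frag_of i) = \<one>"
  shows "\<phi> \<in> hom (free_Abelian_group (S - {i})) G"
    "carrier G \<subseteq> \<phi> ` carrier (free_Abelian_group (S - {i}))"
proof -
  show "\<phi> \<in> hom (free_Abelian_group (S - {i})) G"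
  proof (rule homI)
    fix x y assume xy: "x \<in> carrier (free_Abelian_group (S - {i}))" "y \<in> carrier (free_Abelian_group (S - {i}))"
    then have xy': "x \<in> carrier (free_Abelian_group S)" "y \<in> carrier (free_Abelian_group S)"
      by auto
    show "\<phi> x \<in> carrier G"
      by (rule hom_in_carrier[OF \<phi>(1) xy'(1)])
    show "\<phi> (x \<otimes>\<^bsub>free_Abelian_group (S - {i})\<^esub> y) = \<phi> x \<otimes> \<phi> y"
      using hom_mult[OF \<phi>(1) xy'] by simp
  qed
  show "carrier G \<subseteq> \<phi> ` carrier (free_Abelian_group (S - {i}))"
  proof
    fix y assume "y \<in> carrier G"
    then obtain x where x: "Poly_Mapping.keys x \<subseteq> S" "y = \<phi> x"
      using \<phi>(2) by auto
    define m where "m = - Poly_Mapping.lookup x i"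
    define z where "z = x + frag_cmul m (frag_of i)"
    have "Poly_Mapping.lookup z k = (if k = i then 0 else Poly_Mapping.lookup x k)" for k
      by (simp add: z_def m_def lookup_add)
    then have z: "Poly_Mapping.keys z \<subseteq> S - {i}"
      using x(1) by (auto simp: in_keys_iff split: if_splits)
    have km: "Poly_Mapping.keys (frag_cmul m (frag_of i)) \<subseteq> S"
      using i(1) by (auto split: if_splits)
    have "\<phi> (frag_cmul m (frag_of i)) = \<phi> (frag_of i) [^] m"
      using hom_int_pow[OF \<phi>(1), of "frag_of i" m] i(1) by (simp add: is_group)
    then have "\<phi> (frag_cmul m (frag_of i)) = \<one>"
      by (simp add: i(2))
    moreover have "\<phi> z = \<phi> x \<otimes> \<phi> (frag_cmul m (frag_of i))"
      unfolding z_def using hom_mult[OF \<phi>(1), of x "frag_cmul m (frag_of i)"] x(1) km by simp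
    ultimately have "\<phi> z = y"
      using x(2) \<open>y \<in> carrier G\<close> by simp
    with z show "y \<in> \<phi> ` carrier (free_Abelian_group (S - {i}))"
      by (auto intro!: image_eqI[of _ _ z])
  qed
qed

text \<open>One subtractive step of the Euclidean algorithm: \<open>s\<close> is -1 for equal signs
  and 1 for opposite signs.\<close>

lemma abs_add_sgn_less:
  fixes a b :: int
  assumes "a \<noteq> 0" "b \<noteq> 0" "\<bar>b\<bar> \<le> \<bar>a\<bar>"
  obtains s where "\<bar>a + s * b\<bar> < \<bar>a\<bar>"
proof (cases "(a > 0) = (b > 0)")
  case True
  then show thesis using that[of "-1"] assms by auto
next
  case False
  then show thesis using that[of 1] assms by auto
qed

lemma frag_expand_singleton:
  assumes "Poly_Mapping.keys c \<subseteq> {i}"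
  shows "c = frag_cmul (Poly_Mapping.lookup c i) (frag_of i)"
  using assms by (intro poly_mapping_eqI) (auto simp: in_keys_iff)

text \<open>A kernel element is shortened by transvections until it is a multiple of a single generator,
  which must then be trivial by torsion-freeness and can be dropped.\<close>

lemma (in comm_group) free_if_torsion_free_epi_image:
  assumes tf: "\<And>x n. x \<in> carrier G \<Longrightarrow> 0 < n \<Longrightarrow> x [^] (n::nat) = \<one> \<Longrightarrow> x = \<one>"
    and "finite S"
    and "\<phi> \<in> hom (free_Abelian_group S) G" "carrier G \<subseteq> \<phi> ` carrier (free_Abelian_group S)"
  shows "\<exists>n::nat. G \<cong> free_Abelian_group {..<n}"
  using assms(2-)
proof (induction "card S" arbitrary: S \<phi> rule: less_induct)
  case (less S)
  note S = \<open>finite S\<close>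
  have drop: ?case if "\<psi> \<in> hom (free_Abelian_group S) G" "carrier G \<subseteq> \<psi> ` carrier (free_Abelian_group S)"
      "i \<in> S" "\<psi> (frag_of i) = \<one>" for \<psi> i
    by (rule less.hyps[OF card_Diff1_less[OF S that(3)] finite_Diff[OF S] free_epi_drop_generator[OF that]])
  have ker: ?case
    if "\<psi> \<in> hom (free_Abelian_group S) G" "carrier G \<subseteq> \<psi> ` carrier (free_Abelian_group S)"
      "Poly_Mapping.keys c \<subseteq> S" "c \<noteq> 0" "\<psi> c = \<one>" for \<psi> c
    using that
  \<comment> \<open>The descent is on the sum of the absolute coefficients of the kernel element.
    The epimorphism varies with it, since a change of basis alters both.\<close>
  proof (induction "nat (\<Sum>k\<in>S. \<bar>Poly_Mapping.lookup c k\<bar>)" arbitrary: c \<psi> rule: less_induct)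
    case (less c \<psi>)
    note \<psi> = less.prems(1,2) and c = less.prems(3-5)
    obtain i where i: "i \<in> Poly_Mapping.keys c" using c(2) keys_eq_empty[of c] by blast
    show ?case
    proof (cases "Poly_Mapping.keys c \<subseteq> {i}")
      case True
      define m where "m = Poly_Mapping.lookup c i"
      have m: "m \<noteq> 0" using i by (simp add: m_def in_keys_iff)
      have iS: "i \<in> S" using i c(1) by blast
      have fi: "\<psi> (frag_of i) \<in> carrier G"
        by (rule hom_in_carrier[OF \<psi>(1)]) (use iS in simp)
      have "\<psi> (frag_of i) [^] m = \<psi> c"
        using hom_int_pow[OF \<psi>(1), of "frag_of i" m] iS frag_expand_singleton[OF True]
        by (simp add: is_group m_def)
      then have "\<psi> (frag_of i) [^] m = \<one>" using c(3) by simp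
      then have "\<psi> (frag_of i) [^] nat \<bar>m\<bar> = \<one>"
        by (rule int_pow_eq_one_imp_nat_pow[OF fi])
      then have "\<psi> (frag_of i) = \<one>"
        using tf[OF fi, of "nat \<bar>m\<bar>"] m by simp
      from drop[OF \<psi> iS this] show ?thesis .
    next
      case False
      then obtain j where j: "j \<in> Poly_Mapping.keys c" "j \<noteq> i" by blast
      \<comment> \<open>Of two indices in the support, \<open>p\<close> has the coefficient of
        larger or equal absolute value, and this one is reduced.\<close>
      obtain p q where pq: "p \<in> Poly_Mapping.keys c" "q \<in> Poly_Mapping.keys c" "p \<noteq> q"
        "\<bar>Poly_Mapping.lookup c q\<bar> \<le> \<bar>Poly_Mapping.lookup c p\<bar>"
        using i j by (metis linear)
      have "Poly_Mapping.lookup c p \<noteq> 0" "Poly_Mapping.lookup c q \<noteq> 0"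
        using pq by (auto simp: in_keys_iff)
      then obtain s where s: "\<bar>Poly_Mapping.lookup c p + s * Poly_Mapping.lookup c q\<bar> < \<bar>Poly_Mapping.lookup c p\<bar>"
        using abs_add_sgn_less[OF _ _ pq(4)] by blast
      have pS: "p \<in> S" using pq c(1) by blast
      define c' where "c' = transvection p q s c"
      \<comment> \<open>Precomposition with the inverse transvection keeps the map onto and gives
        \<open>\<psi>' c' = \<psi> c\<close>.\<close>
      define \<psi>' where "\<psi>' = \<psi> \<circ> transvection p q (- s)"
      have inv1: "transvection p q (- s) (transvection p q s x) = x" for x
        by (rule transvection_inverse[OF pq(3)])
      have "(\<Sum>k\<in>S. \<bar>Poly_Mapping.lookup c' k\<bar>) < (\<Sum>k\<in>S. \<bar>Poly_Mapping.lookup c k\<bar>)"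
        using S pS s by (intro sum_strict_mono_ex1) (auto simp: c'_def lookup_transvection)
      then have "nat (\<Sum>k\<in>S. \<bar>Poly_Mapping.lookup c' k\<bar>) < nat (\<Sum>k\<in>S. \<bar>Poly_Mapping.lookup c k\<bar>)"
        by (smt (verit) sum_nonneg nat_mono_iff)
      moreover have "\<psi>' \<in> hom (free_Abelian_group S) G"
      proof (rule homI)
        fix x y assume xy: "x \<in> carrier (free_Abelian_group S)" "y \<in> carrier (free_Abelian_group S)"
        have k: "transvection p q (- s) z \<in> carrier (free_Abelian_group S)"
          if "z \<in> carrier (free_Abelian_group S)" for z
          using that keys_transvection[OF _ pS] by simp
        show "\<psi>' x \<in> carrier G"
          using hom_in_carrier[OF \<psi>(1) k[OF xy(1)]] by (simp add: \<psi>'_def)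
        show "\<psi>' (x \<otimes>\<^bsub>free_Abelian_group S\<^esub> y) = \<psi>' x \<otimes> \<psi>' y"
          using hom_mult[OF \<psi>(1) k[OF xy(1)] k[OF xy(2)]] by (simp add: \<psi>'_def transvection_add)
      qed
      moreover have "carrier G \<subseteq> \<psi>' ` carrier (free_Abelian_group S)"
      proof
        fix y assume "y \<in> carrier G"
        then obtain x where x: "Poly_Mapping.keys x \<subseteq> S" "y = \<psi> x" using \<psi>(2) by auto
        then have "y = \<psi>' (transvection p q s x)" by (simp add: \<psi>'_def inv1)
        moreover have "transvection p q s x \<in> carrier (free_Abelian_group S)"
          using keys_transvection[OF x(1) pS] by simp
        ultimately show "y \<in> \<psi>' ` carrier (free_Abelian_group S)" by blast
      qed
      moreover have "Poly_Mapping.keys c' \<subseteq> S"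
        unfolding c'_def by (rule keys_transvection[OF c(1) pS])
      moreover have "c' \<noteq> 0"
      proof
        assume "c' = 0"
        then have "transvection p q (- s) 0 = c" using inv1[of c] by (simp add: c'_def)
        with c(2) show False by (simp add: transvection_def)
      qed
      moreover have "\<psi>' c' = \<one>"
        using c(3) by (simp add: \<psi>'_def c'_def inv1)
      ultimately show ?thesis by (rule less.hyps)
    qed
  qed
  show ?case
  proof (cases "\<exists>c. Poly_Mapping.keys c \<subseteq> S \<and> c \<noteq> 0 \<and> \<phi> c = \<one>")
    case True
    then show ?thesis using ker[OF less.prems(2,3)] by blast
  next
    \<comment> \<open>Without nonzero kernel elements the epimorphism is injective, so it is an
      isomorphism.\<close>
    case False
    interpret \<phi>: group_hom "free_Abelian_group S" G \<phi>
      by (intro group_hom.intro group_hom_axioms.intro group_free_Abelian_group is_group less.prems(2))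
    have "inj_on \<phi> (carrier (free_Abelian_group S))"
      using False by (subst \<phi>.inj_on_one_iff) auto
    moreover have "\<phi> ` carrier (free_Abelian_group S) = carrier G"
      using less.prems(3) hom_in_carrier[OF less.prems(2)] by blast
    ultimately have "free_Abelian_group S \<cong> G"
      using less.prems(2) by (intro is_isoI[of \<phi>] isoI) (auto simp: bij_betw_def)
    then have "G \<cong> free_Abelian_group S"
      using group.iso_sym[OF group_free_Abelian_group] by blast
    moreover have "free_Abelian_group S \<cong> free_Abelian_group {..<card S}"
      using S by (simp add: isomorphic_free_Abelian_groups eqpoll_iff_card)
    ultimately show ?thesis using iso_trans by blast
  qed
qed

text \<open>The universal property of the free abelian group on \<open>F\<close> supplies the
  epimorphism.\<close>

corollary (in comm_group) free_if_torsion_free_finitely_generated: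
  assumes tf: "\<And>x n. x \<in> carrier G \<Longrightarrow> 0 < n \<Longrightarrow> x [^] (n::nat) = \<one> \<Longrightarrow> x = \<one>"
    and F: "finite F" "F \<subseteq> carrier G" "carrier G \<subseteq> generate G F"
  shows "\<exists>n::nat. G \<cong> free_Abelian_group {..<n}"
proof -
  obtain \<phi> where \<phi>: "\<phi> \<in> hom (free_Abelian_group F) G" "\<And>x. x \<in> F \<Longrightarrow> \<phi> (frag_of x) = x"
    using free_Abelian_group_universal[of id F] F(2) by auto
  interpret \<phi>: group_hom "free_Abelian_group F" G \<phi>
    by (intro group_hom.intro group_hom_axioms.intro group_free_Abelian_group is_group \<phi>(1))
  have "F \<subseteq> \<phi> ` carrier (free_Abelian_group F)"
  proof
    fix x assume "x \<in> F"
    then show "x \<in> \<phi> ` carrier (free_Abelian_group F)"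
      by (intro image_eqI[of _ _ "frag_of x"]) (simp_all add: \<phi>(2))
  qed
  from generate_subgroup_incl[OF this \<phi>.img_is_subgroup] F(3)
  have "carrier G \<subseteq> \<phi> ` carrier (free_Abelian_group F)" by (rule order_trans[rotated])
  from free_if_torsion_free_epi_image[OF tf F(1) \<phi>(1) this] show ?thesis .
qed

section \<open>Homomorphisms on one-dimensional cycles\<close>

text \<open>A homomorphism out of the first homology group, presented on cycles and trivial on
  boundaries, so that computations use chains instead of cosets.\<close>

locale cycle_hom = comm_group A for A :: "('g,'m) monoid_scheme" (structure) +
  fixes X :: "'a topology" and h :: "'a chain \<Rightarrow> 'g"
  assumes hom: "h \<in> hom (relcycle_group 1 X {}) A"
    and boundary: "\<And>c. singular_relboundary 1 X {} c \<Longrightarrow> h c = \<one>"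
begin

abbreviation "cycle c \<equiv> singular_relcycle 1 X {} c"

lemma h_closed [simp]: "cycle c \<Longrightarrow> h c \<in> carrier A"
  using hom_in_carrier[OF hom] by simp

lemma h_add: "cycle c \<Longrightarrow> cycle c' \<Longrightarrow> h (c + c') = h c \<otimes> h c'"
  using hom_mult[OF hom] by simp

lemma h_zero: "h 0 = \<one>"
  by (rule boundary) simp

lemma h_uminus:
  assumes "cycle c"
  shows "h (- c) = inv (h c)"
proof -
  have c: "cycle (- c)"
    using assms by (simp only: singular_relcycle_minus)
  have "h (- c) \<otimes> h c = \<one>"
    using h_add[OF c assms] by (simp add: h_zero)
  from inv_equality[OF this] show ?thesis
    using assms c by simp
qed

lemma h_diff:
  assumes "cycle c" "cycle c'"
  shows "h (c - c') = h c \<otimes> inv (h c')"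
  unfolding diff_conv_add_uminus h_uminus[OF assms(2), symmetric]
  using h_add[OF assms(1)] singular_relcycle_minus[THEN iffD2, OF assms(2)] by blast

lemma h_cmul:
  assumes "cycle c"
  shows "h (frag_cmul (int n) c) = h c [^] n"
proof (induction n)
  case (Suc n)
  have "frag_cmul (int (Suc n)) c = frag_cmul (int n) c + c"
    by (simp add: frag_cmul_distrib)
  with Suc assms show ?case
    by (simp add: h_add singular_relcycle_cmul)
qed (simp add: h_zero)

lemma h_homologous:
  assumes "homologous_rel 1 X {} a b" "cycle a"
  shows "h a = h b"
proof -
  have b: "cycle b" using assms homologous_rel_singular_relcycle by blast
  have "h a \<otimes> inv (h b) = \<one>"
    using h_diff[OF assms(2) b] boundary assms(1) by (simp add: homologous_rel_def)
  from mult_inv_eq_one_imp_eq[OF this] show ?thesis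
    using b assms(2) by simp
qed

text \<open>Subtracting the cone over the boundary, built from the chains \<open>\<tau> y\<close>, does not change a cycle
  but splits it into one cycle for each of its simplices.\<close>

lemma cycle_image_in_subgroup:
  assumes H: "subgroup H A" and c: "cycle c"
    and \<tau>: "\<And>g. pathin X g \<Longrightarrow> path_simplex g 0 1 \<in> Poly_Mapping.keys c \<Longrightarrow>
           cycle (\<tau> (g 0) + path_chain g - \<tau> (g 1)) \<and> h (\<tau> (g 0) + path_chain g - \<tau> (g 1)) \<in> H"
  shows "h c \<in> H"
proof -
  \<comment> \<open>Evaluation at the only point of the standard 0-simplex recovers a point from its
    simplex.\<close>
  define pt :: "((nat \<Rightarrow> real) \<Rightarrow> 'a) \<Rightarrow> 'a" where "pt = (\<lambda>s. s (\<lambda>j. if j = 0 then 1 else 0))"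
  define E where "E c = c - frag_extend (\<tau> \<circ> pt) (chain_boundary 1 c)" for c :: "'a chain"
  have pt: "pt (point_simplex y) = y" for y
    by (simp add: pt_def point_simplex_def standard_simplex_0)
  have E_diff: "E (a - b) = E a - E b" for a b
    by (simp add: E_def chain_boundary_diff frag_extend_diff)
  \<comment> \<open>Parts of a cycle need not be cycles, but \<open>E\<close> makes a cycle of every
    chain supported on the simplices of \<open>c\<close>; this permits induction on chains.\<close>
  have "cycle (E d) \<and> h (E d) \<in> H" if "Poly_Mapping.keys d \<subseteq> Poly_Mapping.keys c" for d
    using that
  proof (induction d rule: frag_induction)
    case zero
    have "E 0 = 0" by (simp add: E_def)
    then show ?case using H by (simp add: h_zero subgroup.one_closed)
  next
    case (one \<sigma>)
    then have "singular_simplex 1 X \<sigma>"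
      using c unfolding singular_cycle singular_chain_def by blast
    then obtain g where g: "pathin X g" "\<sigma> = path_simplex g 0 1"
      using singular_simplex_1_eq_path_simplex by metis
    have "E (frag_of \<sigma>) = \<tau> (g 0) + path_chain g - \<tau> (g 1)"
      unfolding E_def g(2) chain_boundary_path_chain by (simp add: frag_extend_diff pt)
    then show ?case using \<tau>[OF g(1)] one g(2) by metis
  next
    case (diff a b)
    then show ?case
      using H by (simp add: E_diff h_diff singular_relcycle_diff
          subgroup.m_closed subgroup.m_inv_closed del: One_nat_def)
  qed
  moreover have "E c = c"
    using c by (simp add: E_def singular_cycle del: One_nat_def)
  ultimately show ?thesis by (metis order_refl)
qed

section \<open>Vanishing on small cycles\<close>

lemma path_simplex_in_subtopology:
  assumes "singular_simplex 1 (subtopology Y V) (path_simplex g 0 1)" "t \<in> {0..1}"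
  shows "g t \<in> V"
proof -
  define e where "e = (\<lambda>i. if i = 0 then 1 - t else if i = Suc 0 then t else 0)"
  have e: "e \<in> standard_simplex (Suc 0)"
    using assms(2) by (auto simp: standard_simplex_1 e_def)
  moreover have "path_simplex g 0 1 e = g t"
    using e by (simp add: path_simplex_def) (simp add: e_def)
  ultimately show ?thesis
    using assms(1) unfolding singular_simplex_subtopology by auto
qed

text \<open>Paths inside \<open>V\<close> from \<open>x\<close> to the points of \<open>V\<close>
  serve as the cone: up to homology in \<open>X\<close> they close each simplex of the cycle to a
  loop at \<open>x\<close> in \<open>V\<close>.\<close>

lemma loops_detect_cycles:
  assumes V: "path_connectedin X V" "x \<in> V"
    and loops: "\<And>\<gamma>. loop_at X x \<gamma> \<Longrightarrow> (\<And>t. t \<in> {0..1} \<Longrightarrow> \<gamma> t \<in> V) \<Longrightarrow> h (path_chain \<gamma>) = \<one>"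
    and c: "singular_relcycle 1 (subtopology X V) {} c"
  shows "h c = \<one>"
proof -
  have "\<forall>y\<in>V. \<exists>g. pathin X g \<and> g \<in> {0..1} \<rightarrow> V \<and> g 0 = x \<and> g 1 = y"
    using V unfolding path_connectedin by blast
  then obtain p where p: "\<And>y. y \<in> V \<Longrightarrow> pathin X (p y)" "\<And>y t. y \<in> V \<Longrightarrow> t \<in> {0..1} \<Longrightarrow> p y t \<in> V"
    "\<And>y. y \<in> V \<Longrightarrow> p y 0 = x" "\<And>y. y \<in> V \<Longrightarrow> p y 1 = y"
    unfolding Pi_iff by metis
  have cX: "cycle c"
    using c unfolding singular_cycle singular_chain_subtopology by blast
  have "h c \<in> {\<one>}"
  proof (rule cycle_image_in_subgroup[OF _ cX, of _ "\<lambda>y. path_chain (p y)"])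
    show "subgroup {\<one>} A" by (rule triv_subgroup)
    fix g assume g: "pathin X g" "path_simplex g 0 1 \<in> Poly_Mapping.keys c"
    have gV: "g t \<in> V" if "t \<in> {0..1}" for t
      using path_simplex_in_subtopology[OF _ that, of X V] g(2) c
      unfolding singular_cycle singular_chain_def by blast
    let ?a = "p (g 0)" and ?b = "\<lambda>t. p (g 1) (1 - t)"
    let ?ag = "path_join ?a g"
    have g01: "g 0 \<in> V" "g 1 \<in> V" using gV by auto
    have ag: "pathin X ?ag" "?ag 0 = x" "?ag 1 = g 1"
      using p g g01 by (auto intro: pathin_path_join simp: path_join_def)
    have b: "pathin X ?b" "?b 0 = g 1" "?b 1 = x"
      using p(1,4,3)[OF g01(2)] pathin_reverse[OF p(1)[OF g01(2)]] by simp_all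
    have l: "loop_at X x (path_join ?ag ?b)"
      using ag b by (auto simp: loop_at_def intro: pathin_path_join) (auto simp: path_join_def)
    have 1: "homologous_rel 1 X {} (path_chain ?a + path_chain g) (path_chain ?ag)"
      using p g g01 by (intro path_chain_join) auto
    have 2: "homologous_rel 1 X {} (- path_chain (p (g 1))) (path_chain ?b)"
      using path_chain_reverse[OF p(1)[OF g01(2)]] homologous_rel_sym by blast
    have 3: "homologous_rel 1 X {} (path_chain ?ag + path_chain ?b) (path_chain (path_join ?ag ?b))"
      using ag b by (intro path_chain_join) auto
    have hom_l: "homologous_rel 1 X {} (path_chain ?a + path_chain g - path_chain (p (g 1)))
        (path_chain (path_join ?ag ?b))"
      using homologous_rel_trans[OF 3 homologous_rel_add[OF 1 2]] by (simp only: diff_conv_add_uminus)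
      have "h (path_chain (path_join ?ag ?b)) = \<one>"
      using loops[OF l] gV p g01 by (auto simp: path_join_def)
    moreover have "cycle (path_chain (path_join ?ag ?b))"
      using l by (intro singular_cycle_loop) (auto simp: loop_at_def)
    then have "cycle (path_chain ?a + path_chain g - path_chain (p (g 1)))"
      using homologous_rel_singular_relcycle[OF hom_l] by simp
    ultimately show "cycle (path_chain ?a + path_chain g - path_chain (p (g 1))) \<and>
      h (path_chain ?a + path_chain g - path_chain (p (g 1))) \<in> {\<one>}"
      using h_homologous[OF hom_l] by simp
  qed
  then show ?thesis by simp
qed

text \<open>Inserting or omitting each \<open>\<gamma> m\<close> according to a set of naturals
  injects the power set of the naturals into the group, against its cardinality.\<close>

lemma nested_loops_contradiction:
  assumes A: "no_inf_divisible A" "carrier A \<prec> (UNIV :: real set)"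
    and X: "t1_space X" "x \<in> topspace X"
    and U: "\<And>m. x \<in> U m" "\<And>m. U (Suc m) \<subseteq> U m"
    and base: "\<And>W. openin X W \<Longrightarrow> x \<in> W \<Longrightarrow> \<exists>m. U m \<subseteq> W"
    and \<gamma>: "\<And>m. loop_at X x (\<gamma> m)" "\<And>m t. t \<in> {0..1} \<Longrightarrow> \<gamma> m t \<in> U m"
    and ne: "\<And>m. h (path_chain (\<gamma> m)) \<noteq> \<one>"
  shows False
proof -
  have loop_cycle: "cycle (path_chain g)" if "loop_at X x g" for g
    using that by (intro singular_cycle_loop) (auto simp: loop_at_def)
  define a where "a m = h (path_chain (\<gamma> m))" for m
  have a: "a m \<in> carrier A" "a m \<noteq> \<one>" for m
    using loop_cycle[OF \<gamma>(1)] ne by (simp_all add: a_def)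
  \<comment> \<open>The exponents are fixed before the set \<open>S\<close> is chosen, as comparing
    two sets requires the same exponents for both.\<close>
  have "\<exists>n::nat. 0 < n \<and> (\<forall>y\<in>carrier A. y [^] n \<noteq> a m)" for m
    using no_inf_divisible_non_divisor[OF A(1) a] by metis
  then obtain n :: "nat \<Rightarrow> nat"
    where n: "\<And>m. 0 < n m" "\<And>m y. y \<in> carrier A \<Longrightarrow> y [^] n m \<noteq> a m"
    by metis
  have "\<exists>\<beta>. \<forall>m. loop_at X x (\<beta> m) \<and>
      homologous_rel 1 X {} (path_chain (\<beta> m))
        (path_chain (if m \<in> S then \<gamma> m else (\<lambda>_. x)) + frag_cmul (int (n m)) (path_chain (\<beta> (Suc m))))"
    for S
  proof -
    \<comment> \<open>An omitted loop is replaced by the constant one, whose class is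
      trivial.\<close>
    define \<delta> where "\<delta> = (\<lambda>m. if m \<in> S then \<gamma> m else (\<lambda>_. x))"
    have \<delta>: "loop_at X x (\<delta> m)" "t \<in> {0..1} \<Longrightarrow> \<delta> m t \<in> U m" for m t
      using \<gamma> U X by (auto simp: \<delta>_def loop_at_const)
    obtain \<beta> where "\<And>m. loop_at X x (\<beta> m)"
      "\<And>m. homologous_rel 1 X {} (path_chain (\<beta> m))
            (path_chain (\<delta> m) + frag_cmul (int (n m)) (path_chain (\<beta> (Suc m))))"
      using nested_loop_chains_exist[where \<gamma> = \<delta> and n = n, OF X U base \<delta>] by metis
    then show ?thesis unfolding \<delta>_def by blast
  qed
  then obtain \<beta> where \<beta>: "\<And>S m. loop_at X x (\<beta> S m)"
    "\<And>S m. homologous_rel 1 X {} (path_chain (\<beta> S m))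
        (path_chain (if m \<in> S then \<gamma> m else (\<lambda>_. x)) + frag_cmul (int (n m)) (path_chain (\<beta> S (Suc m))))"
    by metis
  define b where "b S m = h (path_chain (\<beta> S m))" for S m
  have "inj (\<lambda>S. b S 0)"
  proof (rule nested_sums_inj[OF A(1) a(1) n])
    show b: "b S m \<in> carrier A" for S m
      using loop_cycle[OF \<beta>(1)] by (simp add: b_def)
    show "b S m = (if m \<in> S then a m else \<one>) \<otimes> b S (Suc m) [^] n m" for S m
    proof -
      let ?g = "if m \<in> S then \<gamma> m else (\<lambda>_. x)"
      have 1: "cycle (path_chain ?g)"
        using \<gamma> X by (intro loop_cycle) (auto simp: loop_at_const)
      have 2: "cycle (path_chain (\<beta> S (Suc m)))"
        by (rule loop_cycle[OF \<beta>(1)])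
      have "b S m = h (path_chain ?g + frag_cmul (int (n m)) (path_chain (\<beta> S (Suc m))))"
        unfolding b_def by (rule h_homologous[OF \<beta>(2) loop_cycle[OF \<beta>(1)]])
      also have "\<dots> = h (path_chain ?g) \<otimes> b S (Suc m) [^] n m"
        unfolding b_def h_cmul[OF 2, symmetric] by (rule h_add[OF 1 singular_relcycle_cmul[OF 2]])
      also have "h (path_chain ?g) = (if m \<in> S then a m else \<one>)"
        using boundary[OF path_chain_const[OF X(2)]] by (simp add: a_def)
      finally show ?thesis .
    qed
  qed
  moreover have "range (\<lambda>S. b S 0) \<subseteq> carrier A"
    using loop_cycle[OF \<beta>(1)] by (auto simp: b_def)
  ultimately have "(UNIV :: nat set set) \<lesssim> carrier A"
    unfolding lepoll_def by blast
  then have "(UNIV :: real set) \<lesssim> carrier A"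
    using nat_sets_eqpoll_reals by (meson eqpoll_imp_lepoll eqpoll_sym lepoll_trans)
  with A(2) show False
    using lesspoll_def lepoll_antisym by blast
qed

text \<open>Otherwise every ball around \<open>x\<close> carries a loop at \<open>x\<close> with
  nontrivial image, and these loops feed the nested construction.\<close>

lemma small_cycles_vanish:
  assumes A: "no_inf_divisible A" "carrier A \<prec> (UNIV :: real set)"
    and X: "metrizable_space X" "locally_path_connected_space X" "x \<in> topspace X"
  shows "\<exists>W. openin X W \<and> x \<in> W \<and> (\<forall>c. singular_relcycle 1 (subtopology X W) {} c \<longrightarrow> h c = \<one>)"
proof (rule ccontr)
  assume no: "\<not> ?thesis"
  obtain M d where M: "Metric_space M d" and XM: "X = Metric_space.mtopology M d"
    using X(1) unfolding metrizable_space_def by blast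
  interpret Metric_space M d by (rule M)
  define U where "U m = mball x (1 / real (Suc m))" for m
  have xM: "x \<in> M" using X(3) by (simp add: XM)
  have "\<exists>\<gamma>. loop_at X x \<gamma> \<and> (\<forall>t\<in>{0..1}. \<gamma> t \<in> U m) \<and> h (path_chain \<gamma>) \<noteq> \<one>" for m
  proof -
    have "openin X (U m)" "x \<in> U m"
      by (auto simp: U_def XM xM)
    \<comment> \<open>Path connectedness of \<open>V\<close> turns a cycle into loops at
      \<open>x\<close>. The sets \<open>V\<close> for different \<open>m\<close> need not be nested,
      so the loop is recorded as lying in the ball \<open>U m\<close>.\<close>
    then obtain V where V: "openin X V" "path_connectedin X V" "x \<in> V" "V \<subseteq> U m"
      using X(2) unfolding locally_path_connected_space by blast
    obtain c where c: "singular_relcycle 1 (subtopology X V) {} c" "h c \<noteq> \<one>"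
      using no V by blast
    then obtain \<gamma> where "loop_at X x \<gamma>" "\<And>t. t \<in> {0..1} \<Longrightarrow> \<gamma> t \<in> V" "h (path_chain \<gamma>) \<noteq> \<one>"
      using loops_detect_cycles[OF V(2,3) _ c(1)] by blast
    with V show ?thesis by blast
  qed
  then obtain \<gamma> where \<gamma>: "\<And>m. loop_at X x (\<gamma> m)" "\<And>m t. t \<in> {0..1} \<Longrightarrow> \<gamma> m t \<in> U m"
    "\<And>m. h (path_chain (\<gamma> m)) \<noteq> \<one>"
    by metis
  show False
  proof (rule nested_loops_contradiction[OF A _ X(3) _ _ _ \<gamma>])
    show "t1_space X" using X(1) by (rule metrizable_imp_t1_space)
    show "x \<in> U m" for m by (simp add: U_def xM)
    show "U (Suc m) \<subseteq> U m" for m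
      unfolding U_def by (intro mball_subset_concentric) (simp add: field_simps)
    show "\<exists>m. U m \<subseteq> W" if W: "openin X W" "x \<in> W" for W
    proof -
      obtain r where r: "r > 0" "mball x r \<subseteq> W"
        using W unfolding XM openin_mtopology by blast
      obtain m where "1 / real (Suc m) < r"
        using r(1) nat_approx_posE by blast
      then have "U m \<subseteq> mball x r"
        unfolding U_def by (intro mball_subset_concentric) simp
      with r show ?thesis by blast
    qed
  qed
qed

section \<open>Finite generation from compactness\<close>

text \<open>A subdivided cycle splits into loops, one per 1-simplex, which run from a base point
  through two of finitely many centres. The value of such a loop depends only on the two centres,
  since two chains with the same ends in one \<open>\<delta>\<close>-ball differ by a cycle with
  trivial image. Pairs of centres therefore index the generators.\<close>

lemma generated_by_finite:
  assumes small: "\<And>x. x \<in> topspace X \<Longrightarrow> \<exists>W. openin X W \<and> x \<in> W \<and>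
      (\<forall>c. singular_relcycle 1 (subtopology X W) {} c \<longrightarrow> h c = \<one>)"
    and X: "metrizable_space X" "compact_space X" "locally_path_connected_space X" "path_connected_space X"
  obtains F where "finite F" "F \<subseteq> carrier A" "\<And>c. cycle c \<Longrightarrow> h c \<in> generate A F"
proof (cases "topspace X = {}")
  case True
  \<comment> \<open>The empty space has no base point, but all its chains are zero.\<close>
  have "h c \<in> generate A {}" if "cycle c" for c
  proof -
    have "c = 0" using that singular_chain_empty[OF True] unfolding singular_cycle by blast
    then show ?thesis by (simp add: h_zero generate.one)
  qed
  then show thesis using that[of "{}"] by blast
next
  case False
  then obtain x0 where x0: "x0 \<in> topspace X" by blast
  obtain M d where M: "Metric_space M d" and XM: "X = Metric_space.mtopology M d"
    using X(1) unfolding metrizable_space_def by blast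
  interpret Metric_space M d by (rule M)
  have top: "topspace X = M" by (simp add: XM)
  define vanishing where "vanishing W \<longleftrightarrow> (\<forall>c. singular_relcycle 1 (subtopology X W) {} c \<longrightarrow> h c = \<one>)" for W
  have "compactin mtopology M"
    using X(2) by (simp add: XM compact_space_def)
  moreover have "M \<subseteq> \<Union>{W. openin X W \<and> vanishing W}"
    using small unfolding top vanishing_def by blast
  moreover have "openin mtopology W" if "W \<in> {W. openin X W \<and> vanishing W}" for W
    using that unfolding XM by blast
  ultimately have "\<exists>\<epsilon>>0. \<forall>x\<in>M. \<exists>W\<in>{W. openin X W \<and> vanishing W}. mball x \<epsilon> \<subseteq> W"
    by (rule lebesgue_number)
  \<comment> \<open>\<open>\<delta>\<close> is a Lebesgue number of the cover by open sets whose
    cycles have trivial image.\<close>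
  then obtain \<delta> where \<delta>: "\<delta> > 0"
    "\<And>x. x \<in> M \<Longrightarrow> \<exists>W\<in>{W. openin X W \<and> vanishing W}. mball x \<delta> \<subseteq> W"
    by blast
  have ball_vanishing: "h c = \<one>" if cx: "singular_relcycle 1 (subtopology X (mball x \<delta>)) {} c" "x \<in> M" for x c
  proof -
    obtain W where "vanishing W" "mball x \<delta> \<subseteq> W" using \<delta>(2)[OF cx(2)] by blast
    with singular_cycle_mono[OF cx(1)] show ?thesis unfolding vanishing_def by blast
  qed
  \<comment> \<open>With radius \<open>\<delta> / 8\<close>, three such sets in a row, each meeting
    the next, lie in the \<open>\<delta>\<close>-ball around the centre of the first.\<close>
  have "\<exists>V. openin X V \<and> path_connectedin X V \<and> y \<in> V \<and> V \<subseteq> mball y (\<delta> / 8)" if "y \<in> M" for y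
  proof -
    have "openin X (mball y (\<delta> / 8))" "y \<in> mball y (\<delta> / 8)"
      using that \<delta>(1) by (auto simp: XM)
    then show ?thesis
      using X(3) unfolding locally_path_connected_space by blast
  qed
  then obtain V where V: "\<And>y. y \<in> M \<Longrightarrow> openin X (V y)" "\<And>y. y \<in> M \<Longrightarrow> path_connectedin X (V y)"
    "\<And>y. y \<in> M \<Longrightarrow> y \<in> V y" "\<And>y. y \<in> M \<Longrightarrow> V y \<subseteq> mball y (\<delta> / 8)"
    by metis
  have "\<exists>Y. finite Y \<and> Y \<subseteq> M \<and> M \<subseteq> \<Union> (V ` Y)"
  proof -
    obtain \<F> where \<F>: "finite \<F>" "\<F> \<subseteq> V ` M" "M \<subseteq> \<Union>\<F>"
      using X(2)[unfolded compact_space_alt top, rule_format, of "V ` M"] V(1,3) by blast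
    obtain Y where "Y \<subseteq> M" "finite Y" "\<F> = V ` Y"
      using finite_subset_image[OF \<F>(1,2)] by blast
    with \<F>(3) show ?thesis by blast
  qed
  then obtain Y where Y: "finite Y" "Y \<subseteq> M" "M \<subseteq> \<Union> (V ` Y)" by blast
  then obtain i where i: "\<And>y. y \<in> M \<Longrightarrow> i y \<in> Y" "\<And>y. y \<in> M \<Longrightarrow> y \<in> V (i y)"
    by (metis UN_iff subsetD)
  have "\<exists>g. pathin X g \<and> g 0 = x0 \<and> g 1 = p" if "p \<in> M" for p
    using X(4) x0 that unfolding path_connected_space_def top by blast
  then obtain \<rho> where \<rho>: "\<And>p. p \<in> M \<Longrightarrow> pathin X (\<rho> p) \<and> \<rho> p 0 = x0 \<and> \<rho> p 1 = p"
    by metis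
  have "\<exists>g. pathin X g \<and> g \<in> {0..1} \<rightarrow> V (i y) \<and> g 0 = i y \<and> g 1 = y" if "y \<in> M" for y
    using V(2)[of "i y"] V(3)[of "i y"] i[OF that] Y(2) unfolding path_connectedin by blast
  then obtain \<theta> where \<theta>: "\<And>y. y \<in> M \<Longrightarrow> pathin (subtopology X (V (i y))) (\<theta> y) \<and> \<theta> y 0 = i y \<and> \<theta> y 1 = y"
    unfolding pathin_subtopology Pi_iff by metis
  \<comment> \<open>Chains rather than paths, since the connection used later is a combination of
    three path chains. The set may be empty for distant centres.\<close>
  define K where "K p q = {k. singular_chain 1 (subtopology X (mball p \<delta>)) k \<and>
      chain_boundary 1 k = frag_of (point_simplex q) - frag_of (point_simplex p)}" for p q
  define loop_via where "loop_via p k q = path_chain (\<rho> p) + k - path_chain (\<rho> q)" for p k q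
  have K_cycle: "cycle (loop_via p k q)" if "k \<in> K p q" "p \<in> M" "q \<in> M" for p q k
  proof -
    have "pathin X (\<rho> p)" "pathin X (\<rho> q)" "singular_chain 1 X k"
      using \<rho>[OF that(2)] \<rho>[OF that(3)] that(1) unfolding K_def singular_chain_subtopology by simp_all
    then have "singular_chain 1 X (loop_via p k q)"
      unfolding loop_via_def
      by (blast intro: singular_chain_diff singular_chain_add singular_chain_path_chain)
    moreover have "chain_boundary 1 (loop_via p k q) = 0"
      using that(1) \<rho>[OF that(2)] \<rho>[OF that(3)]
      unfolding loop_via_def K_def chain_boundary_diff chain_boundary_add chain_boundary_path_chain
      by simp
    ultimately show ?thesis
      unfolding singular_cycle by blast
  qed
  \<comment> \<open>The cone reaches \<open>y\<close> through its centre \<open>i y\<close>; the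
    part beyond the centre stays in \<open>V (i y)\<close>.\<close>
  define \<tau> where "\<tau> y = path_chain (\<rho> (i y)) + path_chain (\<theta> y)" for y
  define F where "F p q = (\<lambda>k. h (loop_via p k q)) ` K p q" for p q
  have F_finite: "finite (F p q)" if pq: "p \<in> M" "q \<in> M" for p q
  proof -
    have eq: "h (loop_via p k q) = h (loop_via p k' q)" if k: "k \<in> K p q" "k' \<in> K p q" for k k'
    proof -
      have "singular_relcycle 1 (subtopology X (mball p \<delta>)) {} (k - k')"
        unfolding singular_cycle using k
        by (simp add: K_def chain_boundary_diff singular_chain_diff del: One_nat_def)
      then have "h (k - k') = \<one>" by (rule ball_vanishing[OF _ pq(1)])
      moreover have "loop_via p k q - loop_via p k' q = k - k'"
        by (simp add: loop_via_def)
      ultimately have "h (loop_via p k q) \<otimes> inv (h (loop_via p k' q)) = \<one>"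
        using h_diff[OF K_cycle[OF k(1) pq] K_cycle[OF k(2) pq]] by (simp only:)
      then show ?thesis
        by (rule mult_inv_eq_one_imp_eq) (use K_cycle k pq in simp_all)
    qed
    \<comment> \<open>If \<open>K p q\<close> is empty, the \<open>SOME\<close> chain is arbitrary
      and the inclusion is trivial.\<close>
    have "F p q \<subseteq> {h (loop_via p (SOME k. k \<in> K p q) q)}"
      unfolding F_def
    proof (rule image_subsetI)
      fix k assume k: "k \<in> K p q"
      then have "(SOME k. k \<in> K p q) \<in> K p q"
        by (rule someI[of "\<lambda>k. k \<in> K p q"])
      from eq[OF k this] show "h (loop_via p k q) \<in> {h (loop_via p (SOME k. k \<in> K p q) q)}"
        by (simp only: singleton_iff)
    qed
    then show ?thesis by (rule finite_subset) simp
  qed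
  define G where "G = (\<Union>p\<in>Y. \<Union>q\<in>Y. F p q)"
  have G: "finite G" "G \<subseteq> carrier A"
  proof -
    show "finite G"
      unfolding G_def by (intro finite_UN_I Y(1) F_finite) (use Y(2) in blast)+
    show "G \<subseteq> carrier A"
    proof
      fix z assume "z \<in> G"
      then obtain p q k where "p \<in> Y" "q \<in> Y" "k \<in> K p q" "z = h (loop_via p k q)"
        unfolding G_def F_def by blast
      then show "z \<in> carrier A"
        using h_closed[OF K_cycle[of k p q]] Y(2) by blast
    qed
  qed
  have "h c \<in> generate A G" if c: "cycle c" for c
  proof -
    have "\<And>U. U \<in> V ` Y \<Longrightarrow> openin X U" "topspace X \<subseteq> \<Union> (V ` Y)"
      using V(1) Y top by auto
    \<comment> \<open>Subdivision: a homologous cycle has each of its simplices in one set of the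
      finite cover.\<close>
    from small_homologous_rel_relcycle_exists[OF this c]
    obtain c' where c': "cycle c'" "homologous_rel 1 X {} c c'"
      "\<And>f. f \<in> Poly_Mapping.keys c' \<Longrightarrow> \<exists>U\<in>V ` Y. f \<in> standard_simplex 1 \<rightarrow> U"
      by metis
    have "h c' \<in> generate A G"
    proof (rule cycle_image_in_subgroup[OF generate_is_subgroup[OF G(2)] c'(1),
          of \<tau>])
      fix g assume g: "pathin X g" "path_simplex g 0 1 \<in> Poly_Mapping.keys c'"
      obtain j where j: "j \<in> Y" "path_simplex g 0 1 \<in> standard_simplex 1 \<rightarrow> V j"
        using c'(3)[OF g(2)] by blast
      have "singular_simplex 1 (subtopology X (V j)) (path_simplex g 0 1)"
        unfolding singular_simplex_subtopology using j(2) singular_simplex_path_simplex[OF g(1), of 0 1]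
        by auto
      note g_small = this
      define a b where "a = g 0" and "b = g 1"
      have abj: "a \<in> V j" "b \<in> V j"
        unfolding a_def b_def by (rule path_simplex_in_subtopology[OF g_small]; simp)+
      have jM: "j \<in> M" using j Y by blast
      have abM: "a \<in> M" "b \<in> M" using abj V(4)[OF jM] by auto
      have iM: "i a \<in> M" "i b \<in> M" using i(1) abM Y by blast+
      let ?k = "path_chain (\<theta> a) + path_chain g - path_chain (\<theta> b)"
      have ball: "V (i a) \<subseteq> mball (i a) \<delta>" "V j \<subseteq> mball (i a) \<delta>" "V (i b) \<subseteq> mball (i a) \<delta>"
      proof -
        have d1: "d (i a) a < \<delta> / 8" "d j a < \<delta> / 8" "d j b < \<delta> / 8" "d (i b) b < \<delta> / 8"
          using subsetD[OF V(4)[OF iM(1)] i(2)[OF abM(1)]] subsetD[OF V(4)[OF iM(2)] i(2)[OF abM(2)]]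
            subsetD[OF V(4)[OF jM] abj(1)] subsetD[OF V(4)[OF jM] abj(2)] by simp_all
        have d2: "d (i a) j < \<delta> / 4"
          using triangle[of "i a" a j] d1 iM jM abM commute[of j a] \<delta>(1) by linarith
        have d3: "d (i a) (i b) < \<delta> / 2"
          using triangle[of "i a" j b] triangle[of "i a" b "i b"] d1 d2 iM jM abM commute[of "i b" b] \<delta>(1) by linarith
        show "V (i a) \<subseteq> mball (i a) \<delta>"
          by (rule subset_trans[OF V(4)[OF iM(1)] mball_subset_concentric]) (use \<delta>(1) in simp)
        show "V j \<subseteq> mball (i a) \<delta>"
        proof
          fix z assume "z \<in> V j"
          then have z: "z \<in> M" "d j z < \<delta> / 8" using V(4)[OF jM] by auto
          then have "d (i a) z < \<delta>"
            using triangle[of "i a" j z] d2 iM jM \<delta>(1) by linarith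
          with z iM show "z \<in> mball (i a) \<delta>" by simp
        qed
        show "V (i b) \<subseteq> mball (i a) \<delta>"
        proof
          fix z assume "z \<in> V (i b)"
          then have z: "z \<in> M" "d (i b) z < \<delta> / 8" using V(4)[OF iM(2)] by auto
          then have "d (i a) z < \<delta>"
            using triangle[of "i a" "i b" z] d3 iM \<delta>(1) by linarith
          with z iM show "z \<in> mball (i a) \<delta>" by simp
        qed
      qed
      have "singular_chain 1 (subtopology X (mball (i a) \<delta>)) ?k"
      proof (intro singular_chain_diff singular_chain_add)
        show "singular_chain 1 (subtopology X (mball (i a) \<delta>)) (path_chain (\<theta> a))"
          using \<theta>[OF abM(1)] by (blast intro: singular_chain_mono[OF singular_chain_path_chain ball(1)])
        show "singular_chain 1 (subtopology X (mball (i a) \<delta>)) (path_chain g)"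
          using singular_chain_mono[OF _ ball(2)] g_small unfolding singular_chain_of[symmetric] .
        show "singular_chain 1 (subtopology X (mball (i a) \<delta>)) (path_chain (\<theta> b))"
          using \<theta>[OF abM(2)] by (blast intro: singular_chain_mono[OF singular_chain_path_chain ball(3)])
      qed
      moreover have "chain_boundary 1 ?k = frag_of (point_simplex (i b)) - frag_of (point_simplex (i a))"
        using \<theta>[OF abM(1)] \<theta>[OF abM(2)] unfolding chain_boundary_diff chain_boundary_add chain_boundary_path_chain
        by (simp add: a_def b_def)
      ultimately have k: "?k \<in> K (i a) (i b)"
        by (simp add: K_def del: One_nat_def)
      have "h (loop_via (i a) ?k (i b)) \<in> generate A G"
        using k i(1) abM unfolding G_def F_def by (blast intro: generate.incl)
      \<comment> \<open>The short ends of \<open>\<tau>\<close> move into the connecting chain,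
        which leaves only the fixed paths to the two centres.\<close>
      moreover have "loop_via (i a) ?k (i b) = \<tau> (g 0) + path_chain g - \<tau> (g 1)"
        by (simp add: loop_via_def \<tau>_def a_def b_def algebra_simps)
      ultimately show "cycle (\<tau> (g 0) + path_chain g - \<tau> (g 1)) \<and>
          h (\<tau> (g 0) + path_chain g - \<tau> (g 1)) \<in> generate A G"
        using K_cycle[OF k iM] by (simp only: simp_thms)
    qed
    with h_homologous[OF c'(2) c] show ?thesis by simp
  qed
  with G that show thesis by blast
qed

end

section \<open>Application to the first homology group\<close>

theorem theorem3p6:
  fixes X :: "'a topology"
  assumes "Peano_continuum X"
    and "carrier (inffree (homology_group 1 X)) \<prec> (UNIV :: real set)"
  shows "\<exists>n::nat. inffree (homology_group 1 X) \<cong> free_Abelian_group {..<n}"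
proof -
  define G where "G = homology_group 1 X"
  define K where "K = inffree_kernel G"
  define cls where "cls = homologous_rel_set 1 X {}"
  \<comment> \<open>The homology class of a cycle, followed by the projection to the
    quotient.\<close>
  define h where "h = (\<lambda>a. K #>\<^bsub>G\<^esub> a) \<circ> cls"
  interpret G: comm_group G
    unfolding G_def by (rule abelian_homology_group)
  have K: "subgroup K G"
    unfolding K_def by (rule G.subgroup_inffree_kernel)
  then have K_normal: "K \<lhd> G"
    using G.normal_iff_subgroup by blast
  interpret A: comm_group "inffree G"
    using G.abelian_FactGroup[OF K] unfolding inffree_def K_def .
  \<comment> \<open>Homology as cycles modulo boundaries makes the class map the canonical
    projection, hence a homomorphism.\<close>
  have G_Mod: "G = relcycle_group 1 X {} Mod singular_relboundary_set 1 X {}"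
    unfolding G_def using nontrivial_relative_homology_group[of 1 X "{}"] by simp
  have cls: "cls \<in> hom (relcycle_group 1 X {}) G"
    unfolding G_Mod cls_def
    using normal.r_coset_hom_Mod[OF normal_subgroup_singular_relboundary_relcycle[of 1 X "{}"]]
    unfolding right_coset_singular_relboundary .
  have carrier_G: "carrier G = cls ` singular_relcycle_set 1 X {}"
    unfolding G_def cls_def using carrier_relative_homology_group[of 1 X "{}"] by simp
  have one_G: "\<one>\<^bsub>G\<^esub> = singular_relboundary_set 1 X {}"
    unfolding G_def using one_relative_homology_group[of 1 X "{}"] by simp
  interpret cycle_hom "inffree G" X h
  proof
    show "h \<in> hom (relcycle_group 1 X {}) (inffree G)"
      unfolding h_def inffree_def K_def[symmetric]
      by (rule hom_compose[OF cls normal.r_coset_hom_Mod[OF K_normal]])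
    show "h c = \<one>\<^bsub>inffree G\<^esub>" if "singular_relboundary 1 X {} c" for c
    proof -
      have "cls c = \<one>\<^bsub>G\<^esub>"
        using that homologous_rel_set_eq_relboundary[of 1 X "{}" c] unfolding cls_def one_G by blast
      then show ?thesis
        using G.coset_join2[OF G.one_closed K subgroup.one_closed[OF K]]
        by (simp add: h_def inffree_def K_def)
    qed
  qed
  have no_inf: "no_inf_divisible (inffree G)"
    by (rule G.no_inf_divisible_inffree)
  have X: "metrizable_space X" "compact_space X" "locally_path_connected_space X" "path_connected_space X"
    using assms(1) by (simp_all add: Peano_continuum_def)
  obtain F where F: "finite F" "F \<subseteq> carrier (inffree G)"
    "\<And>c. singular_relcycle 1 X {} c \<Longrightarrow> h c \<in> generate (inffree G) F"
    using generated_by_finite[OF small_cycles_vanish[OF no_inf assms(2)[folded G_def] X(1,3)] X] by blast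
  \<comment> \<open>Every element of the quotient comes from a cycle, so generating the values on
    cycles generates the whole group.\<close>
  have "carrier (inffree G) = h ` singular_relcycle_set 1 X {}"
    unfolding inffree_def carrier_FactGroup carrier_G h_def K_def by (simp only: image_comp)
  then have gen: "carrier (inffree G) \<subseteq> generate (inffree G) F"
    by (simp only:) (intro image_subsetI F(3), simp only: mem_Collect_eq)
  from A.free_if_torsion_free_finitely_generated[OF A.no_inf_divisible_torsion_free[OF no_inf] F(1,2) gen]
  show ?thesis
    unfolding G_def by this
qed

end
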